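(* If $H$ is a 2-connected hypomatchable graph (parallel edges allowed), then its line graph $L(H)$ is either a clique, an odd hole, or $N_+$-imperfect.
   Context: A graph $H$ is hypomatchable if for every node $v$, $H-v$ has a perfect matching; it is 2-connected if it is connected and remains connected after removing any single node. The line graph $L(H)$ has the edges of $H$ as nodes, two adjacent iff they share an endnode. An odd hole is a chordless cycle on $2k+1\ge5$ nodes. For a graph $G=(V,E)$, $V=\{1,\dots,n\}$: ${\rm ESTAB}(G)=\{x\in\mathbb{R}^n_+: x_i+x_j\le1\ \forall ij\in E\}$, ${\rm STAB}(G)$ is the convex hull of incidence vectors of stable sets. For convex $K\subseteq[0,1]^n$, $\mathrm{cone}(K)=\{(x_0,x): x=x_0y, y\in K\}$; $M_+(K)$ is the set of symmetric PSD $(n+1)\times(n+1)$ matrices $Y$ (indices $0,\dots,n$) with $Ye_0=\mathrm{diag}(Y)$, $Ye_i\in\mathrm{cone}(K)$, $Y(e_0-e_i)\in\mathrm{cone}(K)$ for $i=1,\dots,n$; $N_+(K)=\{x\in[0,1]^n:(1,x)^T=Ye_0 \text{ for some } Y\in M_+(K)\}$. $G$ is $N_+$-perfect if $N_+({\rm ESTAB}(G))={\rm STAB}(G)$, otherwise $N_+$-imperfect. *)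

theory Defs
  imports "HOL-Analysis.Analysis"
begin

text \<open>Undirected finite loopless graphs in which distinct edges may have the same pair of ends.\<close>

record ('v, 'e) multigraph =
  nodes :: "'v set"
  edges :: "'e set"
  ends :: "'e \<Rightarrow> 'v set"

definition wf_multigraph :: "('v, 'e) multigraph \<Rightarrow> bool" where
  "wf_multigraph H \<longleftrightarrow> finite (nodes H) \<and> finite (edges H) \<and>
     (\<forall>e\<in>edges H. ends H e \<subseteq> nodes H \<and> card (ends H e) = 2)"

definition delete_node :: "('v, 'e) multigraph \<Rightarrow> 'v \<Rightarrow> ('v, 'e) multigraph" where
  "delete_node H v =
     \<lparr> nodes = nodes H - {v}, edges = {e \<in> edges H. v \<notin> ends H e}, ends = ends H \<rparr>"

definition perfect_matching :: "('v, 'e) multigraph \<Rightarrow> 'e set \<Rightarrow> bool" where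
  "perfect_matching H M \<longleftrightarrow>
     M \<subseteq> edges H \<and> (\<forall>u\<in>nodes H. \<exists>!e. e \<in> M \<and> u \<in> ends H e)"

definition hypomatchable :: "('v, 'e) multigraph \<Rightarrow> bool" where
  "hypomatchable H \<longleftrightarrow> (\<forall>v\<in>nodes H. \<exists>M. perfect_matching (delete_node H v) M)"

definition connected_graph :: "('v, 'e) multigraph \<Rightarrow> bool" where
  "connected_graph H \<longleftrightarrow>
     (\<forall>u\<in>nodes H. \<forall>w\<in>nodes H. (u, w) \<in> {(a, b). \<exists>e\<in>edges H. ends H e = {a, b}}\<^sup>*)"

definition two_connected :: "('v, 'e) multigraph \<Rightarrow> bool" where
  "two_connected H \<longleftrightarrow>
     connected_graph H \<and> (\<forall>v\<in>nodes H. connected_graph (delete_node H v))"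

text \<open>A simple graph is given by its node set and its set of edges, the latter being
  two-element sets of nodes.\<close>

type_synonym 'a sgraph = "'a set \<times> 'a set set"

definition line_graph :: "('v, 'e) multigraph \<Rightarrow> 'e sgraph" where
  "line_graph H = (edges H,
     {{e, f} | e f. e \<in> edges H \<and> f \<in> edges H \<and> e \<noteq> f \<and> ends H e \<inter> ends H f \<noteq> {}})"

definition is_clique :: "'a sgraph \<Rightarrow> bool" where
  "is_clique G \<longleftrightarrow> (\<forall>i\<in>fst G. \<forall>j\<in>fst G. i \<noteq> j \<longrightarrow> {i, j} \<in> snd G)"

definition is_odd_hole :: "'a sgraph \<Rightarrow> bool" where
  "is_odd_hole G \<longleftrightarrow> (\<exists>(k::nat) c. 5 \<le> 2 * k + 1 \<and> bij_betw c {..<2 * k + 1} (fst G) \<and>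
     (\<forall>i<2 * k + 1. \<forall>j<2 * k + 1. {c i, c j} \<in> snd G \<longleftrightarrow>
        j = (i + 1) mod (2 * k + 1) \<or> i = (j + 1) mod (2 * k + 1)))"

definition stable_set :: "'a sgraph \<Rightarrow> 'a set \<Rightarrow> bool" where
  "stable_set G S \<longleftrightarrow> S \<subseteq> fst G \<and> (\<forall>i\<in>S. \<forall>j\<in>S. {i, j} \<notin> snd G)"

text \<open>The node set \<open>V\<close> of a graph is an arbitrary, possibly empty, subset of a finite type
  \<^typ>\<open>'a\<close>. The space of real vectors indexed by \<open>V\<close> is represented as the coordinate subspace of
  \<^typ>\<open>real ^ 'a\<close> consisting of the vectors that vanish outside \<open>V\<close>.\<close>

definition coord_space :: "'a::finite set \<Rightarrow> (real ^ 'a) set" where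
  "coord_space V = {x. \<forall>i. i \<notin> V \<longrightarrow> x $ i = 0}"

definition ESTAB :: "'a::finite sgraph \<Rightarrow> (real ^ 'a) set" where
  "ESTAB G = {x \<in> coord_space (fst G). (\<forall>i\<in>fst G. 0 \<le> x $ i) \<and>
     (\<forall>i j. {i, j} \<in> snd G \<longrightarrow> x $ i + x $ j \<le> 1)}"

definition STAB :: "'a::finite sgraph \<Rightarrow> (real ^ 'a) set" where
  "STAB G = convex hull {(\<chi> i. indicator S i) | S. stable_set G S}"

text \<open>Homogenised vectors and matrices are indexed by \<^typ>\<open>'a option\<close>: the extra index 0 is
  \<^const>\<open>None\<close>, and node \<open>i\<close> becomes \<open>Some i\<close>. The factor \<open>x\<^sub>0\<close> in the cone is
  nonnegative.\<close>

definition cone_of :: "(real ^ 'a::finite) set \<Rightarrow> (real ^ 'a option) set" where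
  "cone_of K = {z. 0 \<le> z $ None \<and> (\<exists>y\<in>K. (\<chi> i. z $ Some i) = z $ None *\<^sub>R y)}"

definition sym_psd :: "real ^ 'n ^ 'n::finite \<Rightarrow> bool" where
  "sym_psd Y \<longleftrightarrow> transpose Y = Y \<and> (\<forall>u. 0 \<le> u \<bullet> (Y *v u))"

text \<open>The second condition says that \<open>Y\<close> is a matrix indexed by 0 and the elements of \<open>V\<close> only;
  by symmetry it suffices to require this of the rows.\<close>

definition M_plus :: "'a::finite set \<Rightarrow> (real ^ 'a) set \<Rightarrow> (real ^ 'a option ^ 'a option) set" where
  "M_plus V K = {Y. sym_psd Y \<and>
     (\<forall>i. i \<notin> V \<longrightarrow> Y $ Some i = 0) \<and>
     Y *v axis None 1 = (\<chi> i. Y $ i $ i) \<and>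
     (\<forall>i\<in>V. Y *v axis (Some i) 1 \<in> cone_of K \<and>
             Y *v (axis None 1 - axis (Some i) 1) \<in> cone_of K)}"

definition N_plus :: "'a::finite set \<Rightarrow> (real ^ 'a) set \<Rightarrow> (real ^ 'a) set" where
  "N_plus V K = {x \<in> coord_space V. (\<forall>i\<in>V. 0 \<le> x $ i \<and> x $ i \<le> 1) \<and>
     (\<exists>Y\<in>M_plus V K. (\<chi> i. case i of None \<Rightarrow> 1 | Some j \<Rightarrow> x $ j) = Y *v axis None 1)}"

definition N_plus_perfect :: "'a::finite sgraph \<Rightarrow> bool" where
  "N_plus_perfect G \<longleftrightarrow> N_plus (fst G) (ESTAB G) = STAB G"

abbreviation N_plus_imperfect :: "'a::finite sgraph \<Rightarrow> bool" where
  "N_plus_imperfect G \<equiv> \<not> N_plus_perfect G"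

end

(* Each edge of H is assigned an affine form 0, y_a or 1 - y_a in the coordinates of a six-node base
   graph, such that adjacent edges receive forms whose sum is at most 1 on the edge polytope of the
   base graph. Such an assignment pulls points of N_+ back to points of N_+; forms alternating between
   y_a and 1 - y_a along a path realise an even subdivision. The two base graphs are the 5-cycle with
   a node replaced by two adjacent copies, and the line graph of the 5-cycle with a chord; explicit
   moment matrices violate their rank inequality x(V) <= 2. Hence L(H) is N_+-imperfect as soon as H
   contains an odd cycle together with an odd ear on it having distinct ends, with at least five
   nodes altogether.

   To find such a subgraph, compare two near-perfect matchings missing the ends of an edge: they give
   an odd cycle C such that H - V(C) is perfectly matched. If C spans H, any further edge is an ear.
   Otherwise grow C by ears within H, two-colouring the new nodes by the parity of the paths linking
   them to C. If no odd ear appears then, by 2-connectedness, the whole of H is reached, and all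
   edges not inside C join a colour class A outside C to C together with the other class B. The
   matching outside C gives |A| = |B|, and after the removal of a node of A the independent
   set B has too few neighbours for a perfect matching. *)
theory Submission
  imports Defs
begin

section \<open>Pulling back points of the lifted relaxation\<close>

datatype form = Zero | Pos nat | Neg nat

fun form_value :: "form \<Rightarrow> (nat \<Rightarrow> real) \<Rightarrow> real" where
  "form_value Zero z = 0"
| "form_value (Pos a) z = z a"
| "form_value (Neg a) z = z 0 - z a"

fun form_within :: "nat \<Rightarrow> form \<Rightarrow> bool" where
  "form_within n Zero \<longleftrightarrow> True"
| "form_within n (Pos a) \<longleftrightarrow> a \<in> {1..n}"
| "form_within n (Neg a) \<longleftrightarrow> a \<in> {1..n}"

text \<open>A syntactic sufficient test for two forms having sum at most \<open>z 0\<close> on the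
  edge cone. \<open>Pos a\<close> and \<open>Neg a\<close> sum to exactly \<open>z 0\<close>, which
  is what permits even subdivisions; two \<open>Neg\<close> forms may exceed it.\<close>

fun compatible :: "(nat \<times> nat) set \<Rightarrow> form \<Rightarrow> form \<Rightarrow> bool" where
  "compatible E (Pos a) (Pos b) \<longleftrightarrow> (a, b) \<in> E \<or> (b, a) \<in> E"
| "compatible E (Pos a) (Neg b) \<longleftrightarrow> a = b"
| "compatible E (Neg a) (Pos b) \<longleftrightarrow> a = b"
| "compatible E (Neg a) (Neg b) \<longleftrightarrow> False"
| "compatible E _ _ \<longleftrightarrow> True"

text \<open>The cone over the edge polytope of the base graph. The explicit bound
  \<open>z a \<le> z 0\<close> keeps \<open>Neg a\<close> nonnegative even at a node
  \<open>a\<close> without neighbours.\<close>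

definition edge_cone :: "nat \<Rightarrow> (nat \<times> nat) set \<Rightarrow> (nat \<Rightarrow> real) set" where
  "edge_cone n E = {z. 0 \<le> z 0 \<and> (\<forall>a\<in>{1..n}. 0 \<le> z a \<and> z a \<le> z 0) \<and>
     (\<forall>(a, b)\<in>E. z a + z b \<le> z 0)}"

text \<open>The index 0 homogenises.\<close>

definition lift_certificate :: "nat \<Rightarrow> (nat \<times> nat) set \<Rightarrow> (nat \<Rightarrow> nat \<Rightarrow> real) \<Rightarrow> bool" where
  "lift_certificate n E Y \<longleftrightarrow>
     (\<exists>d W. \<forall>a\<le>n. \<forall>b\<le>n. Y a b = (\<Sum>k\<le>n. d k * W k a * W k b) \<and> 0 \<le> d a) \<and>
     Y 0 0 = 1 \<and> Y 0 \<in> edge_cone n E \<and>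
     (\<forall>a\<in>{1..n}. Y a a = Y 0 a \<and> Y a \<in> edge_cone n E \<and> (\<lambda>b. Y 0 b - Y a b) \<in> edge_cone n E)"

lemma form_value_sum:
  "form_value f (\<lambda>a. \<Sum>k\<in>K. c k * z k a) = (\<Sum>k\<in>K. c k * form_value f (z k))"
  by (cases f) (simp_all add: right_diff_distrib sum_subtractf)

lemma form_value_cong:
  assumes "form_within n f" "\<And>a. a \<le> n \<Longrightarrow> y a = z a"
  shows "form_value f y = form_value f z"
  using assms by (cases f) auto

lemma form_value_diff:
  "form_value f (\<lambda>a. y a - z a) = form_value f y - form_value f z"
  by (cases f) auto

lemma form_value_bounds:
  assumes "z \<in> edge_cone n E" "form_within n f"
  shows "0 \<le> form_value f z" "form_value f z \<le> z 0"
  using assms by (cases f; auto simp: edge_cone_def)+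

lemma form_value_compatible:
  assumes "z \<in> edge_cone n E" "form_within n f" "form_within n g" "compatible E f g"
  shows "form_value f z + form_value g z \<le> z 0"
proof -
  have "form_value f z \<le> z 0" "form_value g z \<le> z 0"
    using assms form_value_bounds by blast+
  then show ?thesis
    using assms by (cases f; cases g) (auto simp: edge_cone_def)
qed

text \<open>Coordinate \<open>i\<close> of the linear map induced by \<open>\<phi>\<close>, from
  homogenised base vectors to vectors indexed by 0 and the type \<open>'e\<close>.\<close>

fun lift_value :: "('e \<Rightarrow> form) \<Rightarrow> 'e option \<Rightarrow> (nat \<Rightarrow> real) \<Rightarrow> real" where
  "lift_value \<phi> None z = z 0"
| "lift_value \<phi> (Some e) z = form_value (\<phi> e) z"

lemma lift_value_sum:
  "lift_value \<phi> i (\<lambda>a. \<Sum>k\<in>K. c k * z k a) = (\<Sum>k\<in>K. c k * lift_value \<phi> i (z k))"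
  by (cases i) (simp_all add: form_value_sum)

lemma lift_value_diff:
  "lift_value \<phi> i (\<lambda>a. y a - z a) = lift_value \<phi> i y - lift_value \<phi> i z"
  by (cases i) (simp_all add: form_value_diff)

lemma lift_value_cong:
  assumes "\<And>e. form_within n (\<phi> e)" "\<And>a. a \<le> n \<Longrightarrow> y a = z a"
  shows "lift_value \<phi> i y = lift_value \<phi> i z"
proof (cases i)
  case None
  then show ?thesis by (simp add: assms(2))
next
  case (Some e)
  then show ?thesis by simp (rule form_value_cong[OF assms])
qed

lemma sym_psd_gramI:
  fixes Y :: "real ^ 'n ^ 'n::finite"
  assumes "\<And>i j. Y $ i $ j = (\<Sum>k\<in>K. d k * (L i k * L j k))" "\<And>k. k \<in> K \<Longrightarrow> 0 \<le> d k"
  shows "sym_psd Y"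
  unfolding sym_psd_def
proof (intro conjI allI)
  show "transpose Y = Y"
    by (simp add: vec_eq_iff transpose_def assms(1) mult.commute)
next
  fix u :: "real ^ 'n"
  have "u \<bullet> (Y *v u) = (\<Sum>i\<in>UNIV. \<Sum>j\<in>UNIV. \<Sum>k\<in>K. d k * ((u $ i * L i k) * (u $ j * L j k)))"
    by (simp add: inner_vec_def matrix_vector_mult_def assms(1) sum_distrib_left sum_distrib_right
        algebra_simps)
  also have "\<dots> = (\<Sum>k\<in>K. \<Sum>i\<in>UNIV. \<Sum>j\<in>UNIV. d k * ((u $ i * L i k) * (u $ j * L j k)))"
    by (subst sum.swap[of _ K], subst sum.swap[of _ K]) (rule refl)
  also have "\<dots> = (\<Sum>k\<in>K. d k * (\<Sum>i\<in>UNIV. u $ i * L i k)\<^sup>2)"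
    unfolding power2_eq_square sum_product by (simp only: sum_distrib_left)
  finally show "0 \<le> u \<bullet> (Y *v u)"
    using assms(2) by (simp add: sum_nonneg)
qed

lemma lift_value_in_cone:
  fixes G :: "'e::finite sgraph"
  assumes z: "z \<in> edge_cone n E"
    and \<phi>: "\<And>e. form_within n (\<phi> e)" "\<And>e. e \<notin> fst G \<Longrightarrow> \<phi> e = Zero"
    and comp: "\<And>e f. {e, f} \<in> snd G \<Longrightarrow> compatible E (\<phi> e) (\<phi> f)"
  shows "(\<chi> i. lift_value \<phi> i z) \<in> cone_of (ESTAB G)"
proof -
  have z0: "0 \<le> z 0" using z by (simp add: edge_cone_def)
  \<comment> \<open>If \<open>z 0 = 0\<close>, division by zero gives \<open>y = 0\<close>; the
    bounds then force all form values to vanish, so \<open>z\<close> is still \<open>z 0\<close>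
    times \<open>y\<close>.\<close>
  define y where "y = (\<chi> e. form_value (\<phi> e) z / z 0)"
  have "form_value (\<phi> e) z + form_value (\<phi> f) z \<le> z 0" if "{e, f} \<in> snd G" for e f
    using form_value_compatible[OF z \<phi>(1) \<phi>(1) comp[OF that]] .
  then have "y \<in> ESTAB G"
    using z0 \<phi> form_value_bounds[OF z \<phi>(1)]
    by (auto simp: ESTAB_def coord_space_def y_def divide_simps)
  moreover have "form_value (\<phi> e) z = z 0 * y $ e" for e
    using form_value_bounds[OF z \<phi>(1), of e] by (auto simp: y_def)
  ultimately show ?thesis
    using z0 by (auto simp: cone_of_def vec_eq_iff intro!: bexI[of _ y])
qed

text \<open>With \<open>L\<close> the linear map induced by \<open>\<phi>\<close>, the matrix
  \<open>L Y L^T\<close> is the witness: its columns and their complements are images under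
  \<open>L\<close> of vectors that the certificate places in the edge cone.\<close>

lemma lifted_point_in_N_plus:
  fixes G :: "'e::finite sgraph"
  assumes cert: "lift_certificate n E Y"
    and \<phi>: "\<And>e. form_within n (\<phi> e)" "\<And>e. e \<notin> fst G \<Longrightarrow> \<phi> e = Zero"
    and comp: "\<And>e f. {e, f} \<in> snd G \<Longrightarrow> compatible E (\<phi> e) (\<phi> f)"
  shows "(\<chi> e. form_value (\<phi> e) (Y 0)) \<in> N_plus (fst G) (ESTAB G)"
proof -
  obtain d W where Y: "\<And>a b. a \<le> n \<Longrightarrow> b \<le> n \<Longrightarrow> Y a b = (\<Sum>k\<le>n. d k * W k a * W k b)"
    and d: "\<And>k. k \<le> n \<Longrightarrow> 0 \<le> d k"
    using cert unfolding lift_certificate_def by blast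
  have Y00: "Y 0 0 = 1" and Y0: "Y 0 \<in> edge_cone n E"
    and diag: "\<And>a. a \<in> {1..n} \<Longrightarrow> Y a a = Y 0 a"
    and col: "\<And>a. a \<in> {1..n} \<Longrightarrow> Y a \<in> edge_cone n E"
    and cocol: "\<And>a. a \<in> {1..n} \<Longrightarrow> (\<lambda>b. Y 0 b - Y a b) \<in> edge_cone n E"
    using cert unfolding lift_certificate_def by blast+
  have symm: "Y a b = Y b a" if "a \<le> n" "b \<le> n" for a b
    using that by (simp add: Y mult_ac)
  define L where "L = lift_value \<phi>"
  define M :: "real ^ 'e option ^ 'e option" where "M = (\<chi> i j. L i (\<lambda>a. L j (Y a)))"
  \<comment> \<open>Applying \<open>L\<close> in both arguments replaces each Gram factor
    \<open>W k\<close> by its image, with unchanged weights.\<close>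
  have gram: "M $ i $ j = (\<Sum>k\<le>n. d k * (L i (W k) * L j (W k)))" for i j
  proof -
    have "L j (Y a) = (\<Sum>k\<le>n. (d k * L j (W k)) * W k a)" if "a \<le> n" for a
    proof -
      have "L j (Y a) = L j (\<lambda>b. \<Sum>k\<le>n. (d k * W k a) * W k b)"
        unfolding L_def by (rule lift_value_cong[OF \<phi>(1)]) (simp add: Y that)
      also have "\<dots> = (\<Sum>k\<le>n. (d k * L j (W k)) * W k a)"
        unfolding L_def lift_value_sum by (simp add: mult_ac)
      finally show ?thesis .
    qed
    then have "L i (\<lambda>a. L j (Y a)) = L i (\<lambda>a. \<Sum>k\<le>n. (d k * L j (W k)) * W k a)"
      unfolding L_def by (intro lift_value_cong[OF \<phi>(1)]) blast
    then show ?thesis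
      unfolding M_def L_def lift_value_sum by (simp add: mult_ac)
  qed
  have psd: "sym_psd M"
    by (rule sym_psd_gramI[OF gram]) (use d in simp)
  have Mcomm: "M $ i $ j = M $ j $ i" for i j
    by (simp add: gram mult_ac)
  have M_None: "M $ i $ None = L i (Y 0)" for i
  proof -
    have "M $ i $ None = L i (\<lambda>a. Y a 0)" by (simp add: M_def L_def)
    also have "\<dots> = L i (Y 0)"
      unfolding L_def by (rule lift_value_cong[OF \<phi>(1)]) (use symm in simp)
    finally show ?thesis .
  qed
  have M_Pos: "M $ i $ Some e = L i (Y a)" if "\<phi> e = Pos a" for i e a
  proof -
    have a: "a \<in> {1..n}" using \<phi>(1)[of e] that by simp
    have "M $ i $ Some e = L i (\<lambda>b. Y b a)" using that by (simp add: M_def L_def)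
    also have "\<dots> = L i (Y a)"
      unfolding L_def by (rule lift_value_cong[OF \<phi>(1)]) (use symm a in simp)
    finally show ?thesis .
  qed
  have M_Neg: "M $ i $ Some e = L i (\<lambda>b. Y 0 b - Y a b)" if "\<phi> e = Neg a" for i e a
  proof -
    have a: "a \<in> {1..n}" using \<phi>(1)[of e] that by simp
    have "M $ i $ Some e = L i (\<lambda>b. Y b 0 - Y b a)" using that by (simp add: M_def L_def)
    also have "\<dots> = L i (\<lambda>b. Y 0 b - Y a b)"
      unfolding L_def by (rule lift_value_cong[OF \<phi>(1)]) (use symm a in simp)
    finally show ?thesis .
  qed
  have M_Zero: "M $ i $ Some e = 0" if "\<phi> e = Zero" for i e
    using Mcomm[of i "Some e"] that by (simp add: M_def L_def)
  have Mcol: "M *v axis j 1 = (\<chi> i. M $ i $ j)" for j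
    by (simp add: matrix_vector_mult_def axis_def vec_eq_iff if_distrib cong: if_cong)
  have cone: "(\<chi> i. L i z) \<in> cone_of (ESTAB G)" if "z \<in> edge_cone n E" for z
    unfolding L_def by (rule lift_value_in_cone[OF that \<phi> comp])
  have zero: "(\<lambda>_. 0) \<in> edge_cone n E" by (simp add: edge_cone_def split: prod.split)
  have L0: "L i (\<lambda>_. 0) = 0" for i
    unfolding L_def using lift_value_diff[of \<phi> i "\<lambda>_. 0" "\<lambda>_. 0"] by simp
  have M_col_cone: "(\<chi> i. M $ i $ Some e) \<in> cone_of (ESTAB G)" for e
    using \<phi>(1)[of e] cone[OF zero] cone[OF col] cone[OF cocol]
    by (cases "\<phi> e") (simp_all add: M_Zero M_Pos M_Neg L0)
  \<comment> \<open>Passing from \<open>Pos a\<close> to \<open>Neg a\<close> exchanges the column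
    \<open>Y a\<close> with its complement \<open>Y 0 - Y a\<close>; the certificate controls
    both.\<close>
  have M_cocol_cone: "(\<chi> i. M $ i $ None - M $ i $ Some e) \<in> cone_of (ESTAB G)" for e
  proof (cases "\<phi> e")
    case Zero
    then show ?thesis using cone[OF Y0] by (simp add: M_Zero M_None)
  next
    case (Pos a)
    then show ?thesis using \<phi>(1)[of e] cone[OF cocol[of a]]
      by (simp add: M_Pos M_None L_def lift_value_diff)
  next
    case (Neg a)
    then show ?thesis using \<phi>(1)[of e] cone[OF col[of a]]
      by (simp add: M_Neg M_None L_def lift_value_diff)
  qed
  \<comment> \<open>For \<open>Neg a\<close> the diagonal entry is
    \<open>Y 0 0 - 2 * Y 0 a + Y a a\<close>, and \<open>Y a a = Y 0 a\<close> reduces it to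
    \<open>Y 0 0 - Y 0 a\<close>.\<close>
  have M_diag: "M $ i $ i = L i (Y 0)" for i
  proof (cases i)
    case None
    then show ?thesis by (simp add: M_None)
  next
    case (Some e)
    show ?thesis
    proof (cases "\<phi> e")
      case Zero
      then show ?thesis using Some by (simp add: M_Zero L_def)
    next
      case (Pos a)
      then show ?thesis using Some \<phi>(1)[of e] diag[of a] by (simp add: M_Pos L_def)
    next
      case (Neg a)
      then show ?thesis using Some \<phi>(1)[of e] diag[of a] symm[of a 0]
        by (simp add: M_Neg L_def)
    qed
  qed
  have "M \<in> M_plus (fst G) (ESTAB G)"
    unfolding M_plus_def
  proof (intro CollectI conjI allI impI ballI)
    show "M $ Some e = 0" if "e \<notin> fst G" for e
      using \<phi>(2)[OF that] by (simp add: vec_eq_iff M_def L_def)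
    show "M *v axis None 1 = (\<chi> i. M $ i $ i)"
      by (simp add: Mcol M_diag M_None)
    show "M *v axis (Some e) 1 \<in> cone_of (ESTAB G)" for e
      using M_col_cone[of e] by (simp add: Mcol)
    have "M *v (axis None 1 - axis (Some e) 1) = (\<chi> i. M $ i $ None - M $ i $ Some e)" for e
      by (simp add: matrix_vector_mult_diff_distrib Mcol vec_eq_iff)
    then show "M *v (axis None 1 - axis (Some e) 1) \<in> cone_of (ESTAB G)" for e
      using M_cocol_cone[of e] by simp
  qed (rule psd)
  moreover have "(\<chi> i. case i of None \<Rightarrow> 1 | Some j \<Rightarrow> (\<chi> e. form_value (\<phi> e) (Y 0)) $ j) = M *v axis None 1"
    unfolding Mcol by (simp add: vec_eq_iff M_None L_def Y00 split: option.split)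
  ultimately show ?thesis
    using form_value_bounds[OF Y0 \<phi>(1)] \<phi>(2) Y00
    by (auto simp: N_plus_def coord_space_def)
qed

section \<open>Near-perfect matchings and odd cycles\<close>

definition adjacent :: "('v, 'e) multigraph \<Rightarrow> 'v \<Rightarrow> 'v \<Rightarrow> bool" where
  "adjacent H u v \<longleftrightarrow> (\<exists>e\<in>edges H. ends H e = {u, v})"

text \<open>A near-perfect matching missing \<open>r\<close>, encoded as an involution of
  \<open>V\<close>; for irreflexive \<open>R\<close> its only fixed point is
  \<open>r\<close>.\<close>

definition matching_map :: "('v \<Rightarrow> 'v \<Rightarrow> bool) \<Rightarrow> 'v set \<Rightarrow> 'v \<Rightarrow> ('v \<Rightarrow> 'v) \<Rightarrow> bool" where
  "matching_map R V r m \<longleftrightarrow> m r = r \<and>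
     (\<forall>u\<in>V. m u \<in> V \<and> m (m u) = u \<and> (u \<noteq> r \<longrightarrow> R u (m u)))"

lemma adjacent_sym: "adjacent H u v \<Longrightarrow> adjacent H v u"
  by (auto simp: adjacent_def insert_commute)

lemma adjacentD:
  assumes "wf_multigraph H" "adjacent H u v"
  shows "u \<in> nodes H" "v \<in> nodes H" "u \<noteq> v"
proof -
  obtain e where e: "e \<in> edges H" "ends H e = {u, v}" using assms(2) by (auto simp: adjacent_def)
  then have "{u, v} \<subseteq> nodes H" "card {u, v} = 2"
    using assms(1) by (auto simp: wf_multigraph_def)
  then show "u \<in> nodes H" "v \<in> nodes H" "u \<noteq> v" by auto
qed

lemma hypomatchable_matching_map:
  assumes wf: "wf_multigraph H" and "hypomatchable H" and r: "r \<in> nodes H"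
  shows "\<exists>m. matching_map (adjacent H) (nodes H) r m"
proof -
  obtain M where "perfect_matching (delete_node H r) M"
    using assms by (auto simp: hypomatchable_def)
  then have M: "M \<subseteq> {e \<in> edges H. r \<notin> ends H e}"
    and uniq: "\<And>u. u \<in> nodes H \<Longrightarrow> u \<noteq> r \<Longrightarrow> \<exists>!e. e \<in> M \<and> u \<in> ends H e"
    by (auto simp: perfect_matching_def delete_node_def)
  have "\<exists>v e. e \<in> M \<and> ends H e = {u, v} \<and> v \<in> nodes H \<and> v \<noteq> r"
    if u: "u \<in> nodes H - {r}" for u
  proof -
    obtain e where e: "e \<in> M" "u \<in> ends H e" using uniq[of u] u by blast
    then have "ends H e \<subseteq> nodes H" "card (ends H e) = 2" "r \<notin> ends H e"
      using wf M by (auto simp: wf_multigraph_def)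
    moreover from this obtain x y where "ends H e = {x, y}" by (auto simp: card_2_iff)
    ultimately show ?thesis using e by (cases "u = x") (auto simp: insert_commute)
  qed
  then obtain m e where m: "\<And>u. u \<in> nodes H - {r} \<Longrightarrow>
      e u \<in> M \<and> ends H (e u) = {u, m u} \<and> m u \<in> nodes H \<and> m u \<noteq> r"
    by metis
  have inv: "m (m u) = u" if u: "u \<in> nodes H - {r}" for u
  proof -
    have "e (m u) = e u" using uniq[of "m u"] m[OF u] m[of "m u"] by auto
    then have "{m u, m (m u)} = {u, m u}" using m[OF u] m[of "m u"] by auto
    then show ?thesis by (auto simp: doubleton_eq_iff)
  qed
  have "matching_map (adjacent H) (nodes H) r (m(r := r))"
    using m M inv by (fastforce simp: matching_map_def adjacent_def)
  then show ?thesis by blast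
qed

text \<open>The walk starts at the node missed by \<open>m\<close> and applies \<open>m'\<close> and
  \<open>m\<close> in turn. As both are involutions, its first repetition can only be a node staying
  put, and that node is the one missed by \<open>m'\<close>.\<close>

lemma alternating_walk_ends:
  fixes f :: "nat \<Rightarrow> 'v \<Rightarrow> 'v"
  assumes fin: "finite V" and r: "r \<in> V"
    and m: "\<And>u. u \<in> V \<Longrightarrow> m u \<in> V \<and> m (m u) = u" "\<And>u. u \<in> V \<Longrightarrow> m u = u \<longleftrightarrow> u = r"
    and m': "\<And>u. u \<in> V \<Longrightarrow> m' u \<in> V \<and> m' (m' u) = u" "\<And>u. u \<in> V \<Longrightarrow> m' u = u \<longleftrightarrow> u = s"
    and p: "p 0 = r" "\<And>n. p (Suc n) = (if even n then m' (p n) else m (p n))"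
  shows "\<exists>k. inj_on p {..2 * k} \<and> p (2 * k) = s"
proof -
  define f where "f n = (if even n then m' else m)" for n :: nat
  have pV: "p n \<in> V" for n
    by (induction n) (use r m m' p in auto)
  have step: "p (Suc n) = f n (p n)" for n by (simp add: p f_def)
  have f_inv: "f n (f n u) = u" if "u \<in> V" for n u
    using m m' that by (simp add: f_def)
  have "\<exists>N. \<exists>i<N. p i = p N"
  proof -
    have "card (p ` {..card V}) \<le> card V"
      using fin pV by (intro card_mono) auto
    then have "\<not> inj_on p {..card V}" by (auto dest: card_image)
    then show ?thesis by (metis inj_onI linorder_neqE_nat)
  qed
  then obtain N where N: "\<exists>i<N. p i = p N" and least: "\<And>n. n < N \<Longrightarrow> \<not> (\<exists>i<n. p i = p n)"
    using exists_least_iff[of "\<lambda>N. \<exists>i<N. p i = p N"] by blast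
  have inj: "a = b" if "p a = p b" "a < N" "b < N" for a b
    using that least by (metis linorder_neqE_nat)
  obtain i where i: "i < N" "p i = p N" using N by blast
  then obtain M where M: "N = Suc M" by (cases N) auto
  have pi: "f M (p i) = p M" using i step[of M] f_inv[OF pV] by (simp add: M)
  \<comment> \<open>The partner of \<open>p i\<close> under \<open>f M\<close> is
    \<open>p M\<close>. But \<open>p i\<close> already has a partner on the walk: its successor if
    \<open>i\<close> and \<open>M\<close> have equal parity, otherwise its predecessor, or itself if
    \<open>i = 0\<close>. Each of these cases repeats a node before \<open>N\<close>, except
    \<open>i = M\<close>.\<close>
  consider "i = M" | "i < M" "even i = even M" | "i < M" "even i \<noteq> even M" "i \<noteq> 0" | "i < M" "odd M" "i = 0"
    using i M by fastforce
  then show ?thesis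
  proof cases
    case 1
    have "even M"
    proof (rule ccontr)
      assume "odd M"
      then have "p M = p 0" using pi 1 m(2)[OF pV] p(1) by (simp add: f_def)
      then show False using inj[of M 0] M \<open>odd M\<close> by auto
    qed
    then have "p M = s" using pi 1 m'(2)[OF pV] by (simp add: f_def)
    moreover obtain k where "M = 2 * k" using \<open>even M\<close> by blast
    moreover have "inj_on p {..M}" using inj M by (auto intro!: inj_onI)
    ultimately show ?thesis by auto
  next
    case 2
    then have "p (Suc i) = p M" using pi step[of i] by (simp add: f_def)
    then show ?thesis using inj[of "Suc i" M] 2 M by auto
  next
    case 3
    then obtain j where j: "i = Suc j" by (cases i) auto
    then have "p j = p M" using pi step[of j] f_inv[OF pV, of j j] 3 by (simp add: f_def split: if_splits)
    then show ?thesis using inj[of j M] 3 j M by auto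
  next
    case 4
    then have "p M = p 0" using pi m(2)[OF r] p(1) by (auto simp: f_def)
    then show ?thesis using inj[of M 0] 4 M by auto
  qed
qed

text \<open>The alternating path from \<open>r\<close> to \<open>s\<close> has an even number of
  edges, so the edge \<open>s r\<close> closes it to an odd cycle. Its nodes are closed under
  \<open>m\<close>, hence so is the complement.\<close>

lemma nice_odd_cycle:
  assumes fin: "finite V" and irrefl: "\<And>u. \<not> R u u" and symR: "\<And>u v. R u v \<Longrightarrow> R v u"
    and rs: "r \<in> V" "s \<in> V" "R s r"
    and m: "matching_map R V r m" and m': "matching_map R V s m'"
  shows "\<exists>p k. 1 \<le> k \<and> inj_on p {..2 * k} \<and> p ` {..2 * k} \<subseteq> V \<and>
    (\<forall>i<2 * k. R (p i) (p (Suc i))) \<and> R (p (2 * k)) (p 0) \<and>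
    (\<forall>u\<in>V - p ` {..2 * k}. m u \<in> V - p ` {..2 * k} \<and> m (m u) = u \<and> R u (m u))"
proof -
  have mm: "\<And>u. u \<in> V \<Longrightarrow> m u \<in> V \<and> m (m u) = u" "\<And>u. u \<in> V \<Longrightarrow> m u = u \<longleftrightarrow> u = r"
    "\<And>u. u \<in> V \<Longrightarrow> u \<noteq> r \<Longrightarrow> R u (m u)"
    using m irrefl by (auto simp: matching_map_def)
  have mm': "\<And>u. u \<in> V \<Longrightarrow> m' u \<in> V \<and> m' (m' u) = u" "\<And>u. u \<in> V \<Longrightarrow> m' u = u \<longleftrightarrow> u = s"
    "\<And>u. u \<in> V \<Longrightarrow> u \<noteq> s \<Longrightarrow> R u (m' u)"
    using m' irrefl by (auto simp: matching_map_def)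
  define p where "p = rec_nat r (\<lambda>n x. if even n then m' x else m x)"
  have p: "p 0 = r" "\<And>n. p (Suc n) = (if even n then m' (p n) else m (p n))"
    by (simp_all add: p_def)
  have pV: "p n \<in> V" for n
    by (induction n) (use rs mm mm' p in auto)
  obtain k where inj: "inj_on p {..2 * k}" and pk: "p (2 * k) = s"
    using alternating_walk_ends[OF fin rs(1) mm(1,2) mm'(1,2) p] by blast
  have k: "1 \<le> k"
    using pk p(1) rs(3) irrefl by (cases k) auto
  have ne: "p i \<noteq> p j" if "i \<noteq> j" "i \<le> 2 * k" "j \<le> 2 * k" for i j
    using inj that by (auto dest: inj_onD)
  have adj: "R (p i) (p (Suc i))" if "i < 2 * k" for i
  proof (cases "even i")
    case True
    then show ?thesis using ne[of i "2 * k"] that pk mm'(3)[OF pV] p by auto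
  next
    case False
    then have "i \<noteq> 0" by (auto simp: odd_pos)
    then show ?thesis using False ne[of i 0] that mm(3)[OF pV] p by auto
  qed
  \<comment> \<open>\<open>m\<close> fixes \<open>p 0\<close> and pairs each odd position with the
    following even one.\<close>
  have closed: "m (p i) \<in> p ` {..2 * k}" if "i \<le> 2 * k" for i
  proof (cases "even i")
    case True
    show ?thesis
    proof (cases i)
      case 0
      then show ?thesis using p mm(2)[OF rs(1)] by auto
    next
      case (Suc j)
      then have "m (p i) = p j" using True p mm(1)[OF pV] by simp
      then show ?thesis using that Suc by auto
    qed
  next
    case False
    then have "m (p i) = p (Suc i)" "Suc i \<le> 2 * k" using that p by (auto simp: le_less elim: oddE)
    then show ?thesis by auto
  qed
  have "m u \<in> V - p ` {..2 * k} \<and> m (m u) = u \<and> R u (m u)" if u: "u \<in> V - p ` {..2 * k}" for u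
  proof -
    have "m u \<notin> p ` {..2 * k}" using closed mm(1)[of u] u by (metis DiffD1 DiffD2 atMost_iff imageE)
    moreover have "u \<noteq> r" using u p(1) by force
    ultimately show ?thesis using u mm by auto
  qed
  moreover have "R (p (2 * k)) (p 0)" using pk p rs by simp
  ultimately show ?thesis
    using k inj adj pV by (intro exI[of _ p] exI[of _ k] conjI) auto
qed

section \<open>Odd ears\<close>

text \<open>\<open>P @ [x]\<close> and \<open>Q @ [y]\<close> are disjoint paths meeting \<open>C\<close> only in their last nodes; the colour
  \<open>c\<close> records the parity of their lengths. Keeping both paths disjoint turns every new ear on \<open>T\<close>
  into an ear on \<open>C\<close>.\<close>

definition linked :: "('v \<Rightarrow> 'v \<Rightarrow> bool) \<Rightarrow> 'v set \<Rightarrow> 'v set \<Rightarrow> ('v \<Rightarrow> nat) \<Rightarrow> 'v \<Rightarrow> 'v \<Rightarrow> bool" where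
  "linked R C T c u v \<longleftrightarrow> (\<exists>P x Q y. x \<in> C \<and> y \<in> C \<and> x \<noteq> y \<and>
     distinct (P @ Q) \<and> set (P @ Q) \<subseteq> T - C \<and>
     successively R (P @ [x]) \<and> hd (P @ [x]) = u \<and> even (length P + c u) \<and>
     successively R (Q @ [y]) \<and> hd (Q @ [y]) = v \<and> even (length Q + c v))"

text \<open>\<open>J\<close> lists the inner nodes, so its even length means an odd number of edges.
  With \<open>J = []\<close> the ear may be an edge of the cycle itself, which is why nonemptiness
  is tracked separately.\<close>

definition odd_ear :: "('v \<Rightarrow> 'v \<Rightarrow> bool) \<Rightarrow> 'v set \<Rightarrow> 'v \<Rightarrow> 'v list \<Rightarrow> 'v \<Rightarrow> bool" where
  "odd_ear R C x J y \<longleftrightarrow> x \<in> C \<and> y \<in> C \<and> x \<noteq> y \<and> even (length J) \<and>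
     distinct J \<and> set J \<inter> C = {} \<and> successively R (x # J @ [y])"

lemma linked_sym: "linked R C T c u v \<Longrightarrow> linked R C T c v u"
  unfolding linked_def
  by (elim exE conjE, rule exI, rule exI, rule exI, rule exI, intro conjI; (assumption | auto))

lemma successively_rev_sym:
  assumes "\<And>u v. R u v \<Longrightarrow> R v u"
  shows "successively R (rev xs) \<longleftrightarrow> successively R xs"
  unfolding successively_rev by (intro successively_cong) (use assms in auto)

text \<open>\<open>K\<close> avoids \<open>T\<close> and therefore both linking paths. The case
  \<open>K = []\<close> transfers linkedness to a larger set and a colouring of the same
  parities.\<close>

lemma linked_prepend:
  assumes "linked R C T c u b" "successively R (K @ [u])" "distinct K" "set K \<inter> T = {}"
    and "C \<subseteq> T" "T \<union> set K \<subseteq> T'"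
    and "even (length K + c u + c' (hd (K @ [u])))" "even (c b + c' b)"
  shows "linked R C T' c' (hd (K @ [u])) b"
proof -
  obtain P x Q y where *: "x \<in> C" "y \<in> C" "x \<noteq> y" "distinct (P @ Q)" "set (P @ Q) \<subseteq> T - C"
    "successively R (P @ [x])" "hd (P @ [x]) = u" "even (length P + c u)"
    "successively R (Q @ [y])" "hd (Q @ [y]) = b" "even (length Q + c b)"
    using assms(1) unfolding linked_def by blast
  have "distinct ((K @ P) @ Q)" "set ((K @ P) @ Q) \<subseteq> T' - C"
    using * assms by auto
  moreover have "successively R ((K @ P) @ [x])"
    using *(6,7) assms(2) by (auto simp: successively_append_iff)
  moreover have "hd ((K @ P) @ [x]) = hd (K @ [u])"
    using *(7) by (cases K) auto
  moreover have "even (length (K @ P) + c' (hd (K @ [u])))"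
    using *(8) assms(7) by auto
  moreover have "even (length Q + c' b)" using *(11) assms(8) by auto
  ultimately show ?thesis
    unfolding linked_def using * by blast
qed

lemma successively_join:
  assumes "successively R (xs @ [u])" "successively R (u # ys)"
  shows "successively R (xs @ u # ys)"
  using assms by (auto simp: successively_append_iff)

text \<open>The reversed first path, \<open>I\<close> and the second path concatenate to an ear on
  \<open>C\<close>; its parity is read off from the colours. If \<open>I\<close> is empty,
  \<open>u \<notin> C\<close> makes the first path nonempty.\<close>

lemma linked_odd_ear:
  assumes symR: "\<And>u v. R u v \<Longrightarrow> R v u"
    and "linked R C T c u v" "successively R (u # I @ [v])" "distinct I" "set I \<inter> T = {}" "C \<subseteq> T"
    and "even (c u + c v + length I)" and "I \<noteq> [] \<or> u \<notin> C"
  shows "\<exists>x J y. odd_ear R C x J y \<and> J \<noteq> []"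
proof -
  obtain P x Q y where *: "x \<in> C" "y \<in> C" "x \<noteq> y" "distinct (P @ Q)" "set (P @ Q) \<subseteq> T - C"
    "successively R (P @ [x])" "hd (P @ [x]) = u" "even (length P + c u)"
    "successively R (Q @ [y])" "hd (Q @ [y]) = v" "even (length Q + c v)"
    using assms(2) unfolding linked_def by blast
  have ne: "rev P @ I @ Q \<noteq> []" using * assms(8) by auto
  have "even (length (rev P @ I @ Q))" using *(8,11) assms(7) by auto
  moreover have "distinct (rev P @ I @ Q)" using *(4,5) assms(4,5) by auto
  moreover have "set (rev P @ I @ Q) \<inter> C = {}" using *(5) assms(5,6) by auto
  moreover have "successively R (x # (rev P @ I @ Q) @ [y])"
  proof -
    obtain A where A: "rev (P @ [x]) = A @ [u]"
      using *(7) by (metis append_butlast_last_id last_rev rev_is_Nil_conv snoc_eq_iff_butlast)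
    obtain B where B: "Q @ [y] = v # B"
      using *(10) by (metis list.collapse snoc_eq_iff_butlast)
    have "successively R (A @ [u])"
      unfolding A[symmetric] using *(6) successively_rev_sym[of R, OF symR] by blast
    from successively_join[OF this, of "I @ [v]"] assms(3)
    have "successively R ((A @ u # I) @ [v])" by simp
    from successively_join[OF this, of B] *(9)
    have "successively R ((A @ [u]) @ I @ v # B)" by (simp add: B)
    then have "successively R (rev (P @ [x]) @ I @ Q @ [y])" unfolding A B .
    then show ?thesis by simp
  qed
  ultimately have "odd_ear R C x (rev P @ I @ Q) y" using *(1-3) by (simp only: odd_ear_def simp_thms)
  then show ?thesis using ne by blast
qed

text \<open>Induction along the walk: a node already on the simple path found so far shortens that
  path instead of extending it.\<close>

lemma path_into_set:
  assumes "(y, z) \<in> {(a, b). R a b}\<^sup>*" "y \<notin> T" "z \<in> T"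
  shows "\<exists>I v. distinct (y # I) \<and> set (y # I) \<inter> T = {} \<and> v \<in> T \<and> successively R (y # I @ [v])"
  using assms(1,2)
proof (induction rule: converse_rtrancl_induct)
  case base
  then show ?case using assms(3) by blast
next
  case (step y y')
  show ?case
  proof (cases "y' \<in> T")
    case True
    then show ?thesis using step by (intro exI[of _ "[]"] exI[of _ y']) auto
  next
    case False
    then obtain I v where *: "distinct (y' # I)" "set (y' # I) \<inter> T = {}" "v \<in> T" "successively R (y' # I @ [v])"
      using step by blast
    show ?thesis
    proof (cases "y \<in> set (y' # I)")
      case True
      then obtain I1 I2 where I: "y' # I = I1 @ y # I2" by (metis split_list)
      then have "y' # I @ [v] = I1 @ y # I2 @ [v]" by simp
      then have "successively R (I1 @ y # I2 @ [v])" using *(4) by metis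
      then have "successively R (y # I2 @ [v])" by (simp only: successively_append_iff)
      moreover have "distinct (I1 @ y # I2)" "set (I1 @ y # I2) \<inter> T = {}" using *(1,2) I by metis+
      ultimately show ?thesis using *(3) by (intro exI[of _ I2] exI[of _ v]) auto
    next
      case False
      then show ?thesis using * step by (intro exI[of _ "y' # I"] exI[of _ v]) auto
    qed
  qed
qed

section \<open>Growing a linked set by ears\<close>

definition linkage :: "('v \<Rightarrow> 'v \<Rightarrow> bool) \<Rightarrow> 'v set \<Rightarrow> 'v set \<Rightarrow> ('v \<Rightarrow> nat) \<Rightarrow> bool" where
  "linkage R C T c \<longleftrightarrow> C \<subseteq> T \<and> (\<forall>u\<in>C. c u = 0) \<and>
     (\<forall>u\<in>T. \<forall>v\<in>T. u \<noteq> v \<longrightarrow> linked R C T c u v)"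

text \<open>The parity condition says that colouring the ear by distance from \<open>u\<close> or
  from \<open>v\<close> gives the same parities, so every new node may leave the ear at either
  end.\<close>

lemma linkage_extend:
  assumes symR: "\<And>u v. R u v \<Longrightarrow> R v u"
    and link: "linkage R C T c" and uv: "u \<in> T" "v \<in> T" "u \<noteq> v"
    and I: "successively R (u # I @ [v])" "distinct I" "set I \<inter> T = {}"
    and par: "odd (c u + c v + length I)"
  shows "\<exists>c'. linkage R C (T \<union> set I) c'"
proof -
  \<comment> \<open>The \<open>takeWhile\<close> term is the position of \<open>w\<close> on
    \<open>I\<close>, so the colour is \<open>c u\<close> plus the distance from \<open>u\<close>
    along the ear.\<close>
  define c' where "c' w = (if w \<in> set I then c u + 1 + length (takeWhile (\<lambda>x. x \<noteq> w) I) else c w)" for w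
  have C: "C \<subseteq> T" and c0: "\<And>u. u \<in> C \<Longrightarrow> c u = 0"
    and lk: "\<And>u v. u \<in> T \<Longrightarrow> v \<in> T \<Longrightarrow> u \<noteq> v \<Longrightarrow> linked R C T c u v"
    using link by (auto simp: linkage_def)
  have c'_old: "c' w = c w" if "w \<in> T" for w
    using that I(3) by (auto simp: c'_def)
  have c'_new: "c' a = c u + 1 + length I1" if "I = I1 @ a # I2" for I1 a I2
    using that I(2) by (auto simp: c'_def takeWhile_append)
  have bwd: "successively R ((a # rev I1) @ [u])" if "I = I1 @ a # I2" for I1 a I2
  proof -
    have "successively R (u # I1 @ [a])"
      using I(1) successively_append_iff[of R "u # I1 @ [a]" "I2 @ [v]"] unfolding that by simp
    then have "successively R (rev (u # I1 @ [a]))" using successively_rev_sym[of R, OF symR] by blast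
    then show ?thesis by simp
  qed
  have fwd: "successively R ((a # I2) @ [v])" if "I = I1 @ a # I2" for I1 a I2
    using I(1) successively_append_iff[of R "u # I1" "a # I2 @ [v]"] unfolding that by simp
  \<comment> \<open>The new node leaves the ear through \<open>u\<close>, unless \<open>u\<close> is
    the node \<open>b\<close> it must be linked with; then it leaves through
    \<open>v\<close>.\<close>
  have new_old: "linked R C (T \<union> set I) c' a b" if a: "a \<in> set I" and b: "b \<in> T" for a b
  proof -
    obtain I1 I2 where s: "I = I1 @ a # I2" using a by (metis split_list)
    have new: "distinct (a # rev I1)" "distinct (a # I2)" "set (a # rev I1) \<inter> T = {}" "set (a # I2) \<inter> T = {}"
      "set (a # rev I1) \<subseteq> set I" "set (a # I2) \<subseteq> set I"
      using I(2,3) by (auto simp: s)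
    have len: "length I = length I1 + length I2 + 1" by (simp add: s)
    show ?thesis
    proof (cases "b = u")
      case False
      have "linked R C (T \<union> set I) c' (hd ((a # rev I1) @ [u])) b"
        by (rule linked_prepend[OF lk[OF uv(1) b] bwd[OF s]])
          (use False C new c'_old[OF b] c'_new[OF s] in auto)
      then show ?thesis by simp
    next
      case True
      have "linked R C (T \<union> set I) c' (hd ((a # I2) @ [v])) b"
        by (rule linked_prepend[OF lk[OF uv(2) b] fwd[OF s]])
          (use True uv(3) C new c'_old[OF b] c'_new[OF s] par len in auto)
      then show ?thesis by simp
    qed
  qed
  \<comment> \<open>The earlier node \<open>a\<close> runs back to \<open>u\<close> and the later
    node \<open>b\<close> on to \<open>v\<close>; these stretches are disjoint, and
    \<open>u\<close>, \<open>v\<close> are linked in \<open>T\<close>.\<close>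
  have new_new: "linked R C (T \<union> set I) c' a b" if s: "I = I1 @ a # I2 @ b # I3" for a b I1 I2 I3
  proof -
    have new: "distinct (a # rev I1)" "set (a # rev I1) \<inter> T = {}" "distinct (b # I3)"
      "set (b # I3) \<inter> (T \<union> set (a # rev I1)) = {}"
      using I(2,3) by (auto simp: s)
    have sub: "T \<union> set (a # rev I1) \<union> set (b # I3) \<subseteq> T \<union> set I" by (auto simp: s)
    have len: "length I = length I1 + length I2 + length I3 + 2" by (simp add: s)
    have s': "I = (I1 @ a # I2) @ b # I3" by (simp add: s)
    have "linked R C (T \<union> set (a # rev I1)) c' (hd ((a # rev I1) @ [u])) v"
      by (rule linked_prepend[OF lk[OF uv] bwd[OF s]])
        (use new C c'_old[OF uv(2)] c'_new[OF s] in auto)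
    then have l: "linked R C (T \<union> set (a # rev I1)) c' v a"
      using linked_sym by fastforce
    have "linked R C (T \<union> set I) c' (hd ((b # I3) @ [v])) a"
      by (rule linked_prepend[OF l fwd[OF s'] new(3,4) _ sub])
        (use C c'_old[OF uv(2)] c'_new[OF s'] par len in auto)
    then show ?thesis using linked_sym by fastforce
  qed
  have "linked R C (T \<union> set I) c' a b" if ab: "a \<in> T \<union> set I" "b \<in> T \<union> set I" "a \<noteq> b" for a b
  proof -
    consider "a \<in> T" "b \<in> T" | "a \<in> set I" "b \<in> T" | "a \<in> T" "b \<in> set I" | "a \<in> set I" "b \<in> set I"
      using ab by blast
    then show ?thesis
    proof cases
      case 1
      then show ?thesis
        using linked_prepend[OF lk[OF 1 ab(3)], of "[]" "T \<union> set I" c'] C c'_old by auto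
    next
      case 4
      then obtain I1 I2 where s: "I = I1 @ a # I2" by (metis split_list)
      then consider "b \<in> set I1" | "b \<in> set I2" using 4 ab by auto
      then show ?thesis
      proof cases
        case 1
        then obtain J1 J2 where "I1 = J1 @ b # J2" by (metis split_list)
        then show ?thesis using linked_sym[OF new_new[of J1 b J2 a I2]] s by simp
      next
        case 2
        then obtain J1 J2 where "I2 = J1 @ b # J2" by (metis split_list)
        then show ?thesis using new_new[of I1 a J1 b J2] s by simp
      qed
    next
      case 2
      then show ?thesis by (rule new_old)
    next
      case 3
      then show ?thesis by (intro linked_sym[OF new_old])
    qed
  qed
  then have "linkage R C (T \<union> set I) c'"
    using C c0 c'_old by (auto simp: linkage_def)
  then show ?thesis by blast
qed

text \<open>An edge from \<open>y\<close> outside \<open>T\<close> to \<open>u\<close> in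
  \<open>T\<close> is continued from \<open>y\<close> to \<open>T\<close> in the graph without
  \<open>u\<close>. This gives an ear on \<open>T\<close> with distinct ends; the parity that would
  obstruct the extension would yield a nonempty odd ear on \<open>C\<close>.\<close>

lemma linkage_grows:
  assumes symR: "\<And>u v. R u v \<Longrightarrow> R v u"
    and conn: "\<And>u w. u \<in> V \<Longrightarrow> w \<in> V \<Longrightarrow> (u, w) \<in> {(a, b). R a b}\<^sup>*"
    and conn2: "\<And>x u w. x \<in> V \<Longrightarrow> u \<in> V - {x} \<Longrightarrow> w \<in> V - {x} \<Longrightarrow>
      (u, w) \<in> {(a, b). R a b \<and> a \<noteq> x \<and> b \<noteq> x}\<^sup>*"
    and RV: "\<And>u v. R u v \<Longrightarrow> u \<in> V \<and> v \<in> V"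
    and link: "linkage R C T c" and T: "T \<subset> V" and st: "s \<in> T" "t \<in> T" "s \<noteq> t"
    and no_ear: "\<And>x J y. odd_ear R C x J y \<Longrightarrow> J = []"
  shows "\<exists>T' c'. linkage R C T' c' \<and> T \<subset> T' \<and> T' \<subseteq> V"
proof -
  obtain y0 where y0: "y0 \<in> V" "y0 \<notin> T" using T by blast
  have "(y0, s) \<in> {(a, b). R a b}\<^sup>*" using conn y0 st T by blast
  from path_into_set[OF this y0(2) st(1)]
  obtain I u where I: "set (y0 # I) \<inter> T = {}" "u \<in> T" "successively R (y0 # I @ [u])" by blast
  define y where "y = last (y0 # I)"
  have y: "y \<notin> T" using I(1) last_in_set[of "y0 # I"] unfolding y_def by blast
  have yu: "R y u"
    using I(3) successively_append_iff[of R "y0 # I" "[u]"] by (simp add: y_def)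
  have uy: "u \<in> V" "y \<in> V" "u \<noteq> y" using RV[OF yu] y I(2) by auto
  obtain w where w: "w \<in> T" "w \<noteq> u" using st by metis
  have "(y, w) \<in> {(a, b). R a b \<and> a \<noteq> u \<and> b \<noteq> u}\<^sup>*"
    using conn2[of u y w] uy w T by blast
  from path_into_set[OF this y w(1)]
  obtain J v where J: "distinct (y # J)" "set (y # J) \<inter> T = {}" "v \<in> T"
    and J': "successively (\<lambda>a b. R a b \<and> a \<noteq> u \<and> b \<noteq> u) (y # J @ [v])" by blast
  have "successively R (y # J @ [v])"
    by (rule successively_mono[OF J']) blast
  then have ear: "successively R (u # (y # J) @ [v])" using symR[OF yu] by simp
  have "last (y # J) \<noteq> u \<and> v \<noteq> u"
    using J' successively_append_iff[of "\<lambda>a b. R a b \<and> a \<noteq> u \<and> b \<noteq> u" "y # J" "[v]"] by simp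
  then have "u \<noteq> v" by blast
  have lk: "linked R C T c u v" and C: "C \<subseteq> T"
    using link I(2) J(3) \<open>u \<noteq> v\<close> by (auto simp: linkage_def)
  have "odd (c u + c v + length (y # J))"
  proof
    assume "even (c u + c v + length (y # J))"
    from linked_odd_ear[of R, OF symR lk ear J(1,2) C this] no_ear show False by blast
  qed
  from linkage_extend[of R, OF symR link I(2) J(3) \<open>u \<noteq> v\<close> ear J(1,2) this]
  obtain c' where "linkage R C (T \<union> set (y # J)) c'" by blast
  moreover have "set (y # J) \<subseteq> V"
  proof
    fix z assume "z \<in> set (y # J)"
    then obtain J1 J2 where "y # J = J1 @ z # J2" by (metis split_list)
    then have "successively R ((u # J1) @ z # J2 @ [v])" using ear by simp
    then have "R (last (u # J1)) z"
      using successively_append_iff[of R "u # J1" "z # J2 @ [v]"] by simp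
    then show "z \<in> V" using RV by blast
  qed
  ultimately show ?thesis using y T by (intro exI[of _ "T \<union> set (y # J)"] exI[of _ c']) auto
qed

text \<open>Without a nonempty odd ear, a maximal linked set is all of \<open>V\<close>, and its
  colouring makes every edge leaving or avoiding \<open>C\<close> join opposite parities. Counting
  two matchings across the colour classes outside \<open>C\<close> is then contradictory.\<close>

lemma odd_ear_exists:
  assumes fin: "finite V" and irrefl: "\<And>u. \<not> R u u" and symR: "\<And>u v. R u v \<Longrightarrow> R v u"
    and conn: "\<And>u w. u \<in> V \<Longrightarrow> w \<in> V \<Longrightarrow> (u, w) \<in> {(a, b). R a b}\<^sup>*"
    and conn2: "\<And>x u w. x \<in> V \<Longrightarrow> u \<in> V - {x} \<Longrightarrow> w \<in> V - {x} \<Longrightarrow>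
      (u, w) \<in> {(a, b). R a b \<and> a \<noteq> x \<and> b \<noteq> x}\<^sup>*"
    and RV: "\<And>u v. R u v \<Longrightarrow> u \<in> V \<and> v \<in> V"
    and hypo: "\<And>v. v \<in> V \<Longrightarrow> \<exists>m. matching_map R V v m"
    and C: "C \<subset> V" "s \<in> C" "t \<in> C" "s \<noteq> t"
    and m: "\<And>u. u \<in> V - C \<Longrightarrow> m u \<in> V - C \<and> m (m u) = u \<and> R u (m u)"
  shows "\<exists>x J y. odd_ear R C x J y \<and> J \<noteq> []"
proof (rule ccontr)
  assume "\<not> ?thesis"
  then have no_ear: "J = []" if "odd_ear R C x J y" for x J y using that by blast
  have "linked R C C (\<lambda>_. 0) u v" if "u \<in> C" "v \<in> C" "u \<noteq> v" for u v
    unfolding linked_def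
    by (rule exI[of _ "[]"], rule exI[of _ u], rule exI[of _ "[]"], rule exI[of _ v]) (use that in simp)
  then have start: "linkage R C C (\<lambda>_. 0)" by (simp add: linkage_def)
  define \<T> where "\<T> = {T. T \<subseteq> V \<and> (\<exists>c. linkage R C T c)}"
  have "finite \<T>" using fin by (simp add: \<T>_def)
  moreover have "C \<in> \<T>" using C start by (auto simp: \<T>_def)
  ultimately obtain T where T: "T \<in> \<T>" "\<And>T'. T' \<in> \<T> \<Longrightarrow> T \<subseteq> T' \<Longrightarrow> T = T'"
    using finite_has_maximal[of \<T>] by blast
  then obtain c where link: "linkage R C T c" and "T \<subseteq> V" by (auto simp: \<T>_def)
  have CT: "C \<subseteq> T" using link by (simp add: linkage_def)
  have "\<not> T \<subset> V"
  proof
    assume "T \<subset> V"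
    have "s \<in> T" "t \<in> T" using C CT by blast+
    have "\<exists>T' c'. linkage R C T' c' \<and> T \<subset> T' \<and> T' \<subseteq> V"
      by (rule linkage_grows[of R V C T c s t])
        (fact symR conn conn2 RV link \<open>T \<subset> V\<close> \<open>s \<in> T\<close> \<open>t \<in> T\<close> C(4) no_ear)+
    then obtain T' c' where T': "linkage R C T' c'" "T \<subset> T'" "T' \<subseteq> V" by blast
    then have "T' \<in> \<T>" unfolding \<T>_def by blast
    then show False using T(2)[of T'] T'(2) by blast
  qed
  then have TV: "T = V" using \<open>T \<subseteq> V\<close> by blast
  have c0: "c u = 0" if "u \<in> C" for u using link that by (simp add: linkage_def)
  \<comment> \<open>An edge with ends of equal parity would be the middle part \<open>I = []\<close>
    of an odd ear, nonempty because \<open>u \<notin> C\<close>.\<close>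
  have bip: "odd (c u + c v)" if uv: "R u v" "u \<notin> C" for u v
  proof
    assume even: "even (c u + c v)"
    have "u \<noteq> v" using uv(1) irrefl by blast
    then have "linked R C T c u v" using link RV[OF uv(1)] by (simp add: linkage_def TV)
    from linked_odd_ear[of R, OF symR this, of "[]"] even uv no_ear CT show False by auto
  qed
  define A where "A = {u \<in> V - C. odd (c u)}"
  define B where "B = {u \<in> V - C. even (c u)}"
  have finAB: "finite A" "finite B" using fin by (auto simp: A_def B_def)
  have "m ` A \<subseteq> B"
  proof
    fix w assume "w \<in> m ` A"
    then obtain u where u: "w = m u" "u \<in> V - C" "odd (c u)" by (auto simp: A_def)
    then show "w \<in> B" using m[OF u(2)] bip[of u w] by (simp add: B_def)
  qed
  have inj: "inj_on m (V - C)" by (rule inj_on_inverseI[of _ m]) (use m in blast)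
  have "card A \<le> card B"
    by (rule card_inj_on_le[OF inj_on_subset[OF inj] \<open>m ` A \<subseteq> B\<close> finAB(2)]) (auto simp: A_def)
  obtain u where u: "u \<in> V - C" using C by blast
  have "u \<in> A \<or> m u \<in> A"
    using u m[OF u] bip[of u "m u"] by (simp add: A_def)
  then obtain a where a: "a \<in> A" by blast
  then obtain m' where m': "matching_map R V a m'" using hypo[of a] by (auto simp: A_def)
  \<comment> \<open>Nodes of \<open>C\<close> have colour 0, so the partner of a node of
    \<open>B\<close> must lie in \<open>A\<close>; it is not \<open>a\<close>, which
    \<open>m'\<close> misses.\<close>
  have "m' ` B \<subseteq> A - {a}"
  proof
    fix w assume "w \<in> m' ` B"
    then obtain b where b: "b \<in> B" "w = m' b" by blast
    then have bV: "b \<in> V" "b \<notin> C" "even (c b)" by (auto simp: B_def)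
    have "b \<noteq> a" using a bV by (auto simp: A_def)
    then have "R b w" "m' w = b" "w \<in> V" using m' bV b(2) by (auto simp: matching_map_def)
    then have "odd (c w)" using bip[of b w] bV by auto
    moreover have "w \<notin> C" using c0[of w] \<open>odd (c w)\<close> by auto
    moreover have "w \<noteq> a" using \<open>m' w = b\<close> \<open>b \<noteq> a\<close> m' by (auto simp: matching_map_def)
    ultimately show "w \<in> A - {a}" using \<open>w \<in> V\<close> by (auto simp: A_def)
  qed
  moreover have "inj_on m' B"
    by (rule inj_on_inverseI[of _ m']) (use m' in \<open>auto simp: matching_map_def B_def\<close>)
  ultimately have "card B \<le> card (A - {a})"
    using finAB by (intro card_inj_on_le) auto
  also have "\<dots> < card A" using a finAB by (intro card_Diff1_less)
  finally show False using \<open>card A \<le> card B\<close> by simp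
qed

section \<open>Line graphs of odd thetas\<close>

text \<open>Stable sets of the line graph are matchings, and a matching inside at most
  \<open>2 * k + 1\<close> nodes has at most \<open>k\<close> edges. The bound passes to the convex
  hull.\<close>

lemma matching_inequality:
  fixes H :: "('v, 'e::finite) multigraph"
  assumes wf: "wf_multigraph H" and x: "x \<in> STAB (line_graph H)"
    and T: "T \<subseteq> edges H" "\<And>e. e \<in> T \<Longrightarrow> ends H e \<subseteq> U" and U: "finite U" "card U \<le> 2 * k + 1"
  shows "(\<Sum>e\<in>T. x $ e) \<le> real k"
proof -
  let ?P = "{x :: real ^ 'e. (\<Sum>e\<in>T. x $ e) \<le> real k}"
  have "convex ?P"
  proof (rule convexI)
    fix x y :: "real ^ 'e" and u v :: real
    assume *: "x \<in> ?P" "y \<in> ?P" "0 \<le> u" "0 \<le> v" "u + v = 1"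
    have "(\<Sum>e\<in>T. (u *\<^sub>R x + v *\<^sub>R y) $ e) = u * (\<Sum>e\<in>T. x $ e) + v * (\<Sum>e\<in>T. y $ e)"
      by (simp add: sum.distrib sum_distrib_left)
    also have "\<dots> \<le> real k"
      using convex_bound_le[of "\<Sum>e\<in>T. x $ e" "real k" "\<Sum>e\<in>T. y $ e" u v] * by simp
    finally show "u *\<^sub>R x + v *\<^sub>R y \<in> ?P" by simp
  qed
  moreover have "(\<chi> i. indicator S i) \<in> ?P" if S: "stable_set (line_graph H) S" for S
  proof -
    have disj: "ends H e \<inter> ends H f = {}" if "e \<in> S \<inter> T" "f \<in> S \<inter> T" "e \<noteq> f" for e f
      using S that T(1) unfolding stable_set_def line_graph_def by fastforce
    have two: "card (ends H e) = 2" if "e \<in> S \<inter> T" for e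
      using that T(1) wf by (auto simp: wf_multigraph_def)
    then have fin: "finite (ends H e)" if "e \<in> S \<inter> T" for e
      using that by (metis card.infinite zero_neq_numeral)
    have "2 * card (S \<inter> T) = (\<Sum>e\<in>S \<inter> T. card (ends H e))" using two by simp
    also have "\<dots> = card (\<Union>e\<in>S \<inter> T. ends H e)"
      using fin disj by (intro card_UN_disjoint[symmetric]) auto
    also have "\<dots> \<le> card U" using T(2) U(1) by (intro card_mono) auto
    finally have "card (S \<inter> T) \<le> k" using U(2) by simp
    moreover have "(\<Sum>e\<in>T. indicator S e) = real (card (T \<inter> S))"
      by (simp add: indicator_def sum.If_cases)
    ultimately show ?thesis by (simp add: Int_commute)
  qed
  ultimately have "STAB (line_graph H) \<subseteq> ?P"
    unfolding STAB_def by (intro hull_minimal) auto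
  then show ?thesis using x by blast
qed

text \<open>An Eulerian trail of three internally disjoint paths joining two nodes: the even path \<open>w 0 \<dots> w c\<close>,
  the odd path \<open>w c \<dots> w D\<close> back to \<open>w D = w 0\<close>, and the odd path \<open>w D \<dots> w N\<close> to \<open>w N = w c\<close>.\<close>

definition theta_walk ::
  "('v, 'e) multigraph \<Rightarrow> (nat \<Rightarrow> 'v) \<Rightarrow> (nat \<Rightarrow> 'e) \<Rightarrow> nat \<Rightarrow> nat \<Rightarrow> nat \<Rightarrow> bool" where
  "theta_walk H w t c D N \<longleftrightarrow>
     even c \<and> 2 \<le> c \<and> c < D \<and> odd D \<and> D < N \<and> even N \<and>
     (\<forall>i<N. t i \<in> edges H \<and> ends H (t i) = {w i, w (Suc i)}) \<and> inj_on t {..<N} \<and>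
     (\<forall>i j. i < j \<and> j \<le> N \<longrightarrow> w i = w j \<longleftrightarrow> i = 0 \<and> j = D \<or> i = c \<and> j = N)"

text \<open>Besides consecutive edges, only those at a branch node meet: positions \<open>0\<close>,
  \<open>D - 1\<close>, \<open>D\<close> at \<open>w 0 = w D\<close>, and \<open>c - 1\<close>,
  \<open>c\<close>, \<open>N - 1\<close> at \<open>w c = w N\<close>.\<close>

lemma theta_walk_meeting_edges:
  assumes "theta_walk H w t c D N" "i < j" "j < N" "ends H (t i) \<inter> ends H (t j) \<noteq> {}"
  shows "j = Suc i \<or> i = 0 \<and> (j = D - 1 \<or> j = D) \<or> j = N - 1 \<and> (i = c - 1 \<or> i = c)"
proof -
  have coinc: "a = 0 \<and> b = D \<or> a = c \<and> b = N" if "w a = w b" "a < b" "b \<le> N" for a b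
    using assms(1) that unfolding theta_walk_def by blast
  have ends: "ends H (t i) = {w i, w (Suc i)}" "ends H (t j) = {w j, w (Suc j)}"
    and "2 \<le> c" "c < D" "D < N"
    using assms(1-3) by (simp_all add: theta_walk_def)
  have "w i = w j \<or> w i = w (Suc j) \<or> w (Suc i) = w j \<or> w (Suc i) = w (Suc j)"
    using assms(4) unfolding ends by blast
  then show ?thesis
  proof (elim disjE)
    assume "w i = w j"
    then show ?thesis using coinc[of i j] assms(2,3) by force
  next
    assume "w i = w (Suc j)"
    then show ?thesis using coinc[of i "Suc j"] assms(2,3) by force
  next
    assume "w (Suc i) = w j"
    then show ?thesis using coinc[of "Suc i" j] assms(2,3) by (cases "j = Suc i") force+
  next
    assume "w (Suc i) = w (Suc j)"
    then show ?thesis using coinc[of "Suc i" "Suc j"] assms(2,3) by force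
  qed
qed

lemma theta_walk_nodes:
  assumes "theta_walk H w t c D N"
  shows "w ` {..N} = w ` {1..<N}" "card (w ` {1..<N}) = N - 1"
proof -
  have coinc: "i < j \<and> j \<le> N \<longrightarrow> w i = w j \<longleftrightarrow> i = 0 \<and> j = D \<or> i = c \<and> j = N" for i j
    using assms unfolding theta_walk_def by blast
  have *: "2 \<le> c" "c < D" "D < N" using assms by (auto simp: theta_walk_def)
  then have "w 0 = w D" "w c = w N" using coinc[of 0 D] coinc[of c N] by simp_all
  note * = * this
  have "w n \<in> w ` {1..<N}" if n: "n \<le> N" for n
  proof -
    consider "n = 0" | "n = N" | "n \<in> {1..<N}"
      using n by (cases "n = 0"; cases "n = N") auto
    then show ?thesis
    proof cases
      case 1
      then show ?thesis using * by auto
    next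
      case 2
      then have "w n = w c" using * by simp
      then show ?thesis using * imageI[of c "{1..<N}" w] by simp
    qed auto
  qed
  then show "w ` {..N} = w ` {1..<N}" by auto
  have ne: "w i \<noteq> w j" if "0 < i" "i < j" "j < N" for i j
    using that coinc[of i j] by simp
  have "inj_on w {1..<N}"
    by (rule linorder_inj_onI') (use ne in auto)
  then show "card (w ` {1..<N}) = N - 1" by (simp add: card_image)
qed

text \<open>\<open>step\<close> and \<open>branch\<close> together cover all pairs of meeting edges.
  The theta has \<open>N - 1\<close> nodes, an odd number, so \<open>big\<close> contradicts the
  matching inequality with bound \<open>(N - 2) div 2\<close>.\<close>

lemma theta_walk_imperfect:
  fixes H :: "('v, 'e::finite) multigraph"
  assumes wf: "wf_multigraph H" and th: "theta_walk H w t c D N"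
    and cert: "lift_certificate n E Y"
    and f: "\<And>i. form_within n (f i)"
    and step: "\<And>i. Suc i < N \<Longrightarrow> compatible E (f i) (f (Suc i))"
    and branch: "compatible E (f 0) (f (D - 1))" "compatible E (f 0) (f D)"
      "compatible E (f (c - 1)) (f (N - 1))" "compatible E (f c) (f (N - 1))"
    and big: "2 * (\<Sum>i<N. form_value (f i) (Y 0)) > real N - 2"
  shows "N_plus_imperfect (line_graph H)"
proof
  assume perf: "N_plus_perfect (line_graph H)"
  have inj: "inj_on t {..<N}" and tE: "\<And>i. i < N \<Longrightarrow> t i \<in> edges H"
    and ends: "\<And>i. i < N \<Longrightarrow> ends H (t i) = {w i, w (Suc i)}"
    and "even N" "D < N" "c < D"
    using th by (auto simp: theta_walk_def)
  \<comment> \<open>Edges off the theta receive the form 0, which is compatible with every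
    form.\<close>
  define \<phi> where "\<phi> e = (if e \<in> t ` {..<N} then f (inv_into {..<N} t e) else Zero)" for e
  have \<phi>t: "\<phi> (t i) = f i" if "i < N" for i
    using that inj by (simp add: \<phi>_def)
  have comp_sym: "compatible E g h \<Longrightarrow> compatible E h g" for g h
    by (cases g; cases h) auto
  have comp_lt: "compatible E (f i) (f j)" if ij: "i < j" "j < N" and "ends H (t i) \<inter> ends H (t j) \<noteq> {}" for i j
    using theta_walk_meeting_edges[OF th that] step[of i] branch ij by auto
  have comp: "compatible E (\<phi> e) (\<phi> g)" if eg: "{e, g} \<in> snd (line_graph H)" for e g
  proof (cases "e \<in> t ` {..<N} \<and> g \<in> t ` {..<N}")
    case True
    then obtain i j where ij: "i < N" "e = t i" "j < N" "g = t j" by auto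
    have "e \<noteq> g \<and> ends H e \<inter> ends H g \<noteq> {}"
      using eg by (auto simp: line_graph_def doubleton_eq_iff)
    then show ?thesis
      using comp_lt[of i j] comp_sym[OF comp_lt[of j i]] ij \<phi>t
      by (cases i j rule: linorder_cases) (auto simp: Int_commute)
  next
    case False
    then show ?thesis by (cases "\<phi> e"; cases "\<phi> g") (auto simp: \<phi>_def split: if_splits)
  qed
  let ?x = "\<chi> e. form_value (\<phi> e) (Y 0)"
  have "?x \<in> N_plus (fst (line_graph H)) (ESTAB (line_graph H))"
  proof (rule lifted_point_in_N_plus[OF cert _ _ comp])
    show "form_within n (\<phi> e)" for e using f by (simp add: \<phi>_def)
    show "\<phi> e = Zero" if "e \<notin> fst (line_graph H)" for e
      using that tE by (auto simp: \<phi>_def line_graph_def)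
  qed
  then have x: "?x \<in> STAB (line_graph H)"
    using perf by (simp add: N_plus_perfect_def)
  have "(\<Sum>e\<in>t ` {..<N}. ?x $ e) \<le> real ((N - 2) div 2)"
  proof (rule matching_inequality[OF wf x])
    show "t ` {..<N} \<subseteq> edges H" using tE by auto
    show "ends H e \<subseteq> w ` {1..<N}" if "e \<in> t ` {..<N}" for e
      using that ends theta_walk_nodes(1)[OF th] by fastforce
    show "card (w ` {1..<N}) \<le> 2 * ((N - 2) div 2) + 1"
      unfolding theta_walk_nodes(2)[OF th] using \<open>even N\<close> by (auto elim!: evenE)
  qed simp
  also have "(\<Sum>e\<in>t ` {..<N}. ?x $ e) = (\<Sum>i<N. form_value (f i) (Y 0))"
    using inj \<phi>t by (simp add: sum.reindex)
  finally have "2 * (\<Sum>i<N. form_value (f i) (Y 0)) \<le> real (2 * ((N - 2) div 2))"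
    by simp
  also have "2 * ((N - 2) div 2) = N - 2" using \<open>even N\<close> by simp
  also have "real (N - 2) = real N - 2" using \<open>c < D\<close> \<open>D < N\<close> by simp
  finally show False using big by simp
qed

section \<open>The two base graphs and their moment matrices\<close>

definition twin_edges :: "(nat \<times> nat) set" where
  "twin_edges = {(1,2), (2,3), (3,4), (4,5), (5,1), (6,1), (6,4), (6,5)}"

text \<open>Nodes 1 to 5 are the edges of the 5-cycle in cyclic order; 6 is the chord, which misses
  only edge 4.\<close>

definition chord_edges :: "(nat \<times> nat) set" where
  "chord_edges = {(1,2), (2,3), (3,4), (4,5), (5,1), (6,1), (6,2), (6,3), (6,5)}"

text \<open>The node coordinates in row 0 add up to 126/62; in the matrix for the chord graph they
  add up to 153/76. Both exceed 2.\<close>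

definition twin_matrix :: "nat \<Rightarrow> nat \<Rightarrow> real" where
  "twin_matrix a b =
    [[62, 36, 21, 21, 36, 6, 6],
     [36, 36,  0, 18, 18, 0, 0],
     [21,  0, 21,  0, 18, 3, 3],
     [21, 18,  0, 21,  0, 3, 3],
     [36, 18, 18,  0, 36, 0, 0],
     [ 6,  0,  3,  3,  0, 6, 0],
     [ 6,  0,  3,  3,  0, 0, 6]] ! a ! b / 62"

definition chord_matrix :: "nat \<Rightarrow> nat \<Rightarrow> real" where
  "chord_matrix a b =
    [[76, 30, 30, 30, 30, 30, 3],
     [30, 30,  0, 15, 15,  0, 0],
     [30,  0, 30,  0, 15, 15, 0],
     [30, 15,  0, 30,  0, 15, 0],
     [30, 15, 15,  0, 30,  0, 3],
     [30,  0, 15, 15,  0, 30, 0],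
     [ 3,  0,  0,  0,  3,  0, 3]] ! a ! b / 76"

lemma all_le_6: "(\<forall>a\<le>6. P a) \<longleftrightarrow> P 0 \<and> P 1 \<and> P 2 \<and> P 3 \<and> P 4 \<and> P 5 \<and> P (6::nat)"
proof -
  have "(\<forall>a\<le>6. P a) \<longleftrightarrow> (\<forall>a\<in>{..6}. P a)" by auto
  also have "{..6} = {0, 1, 2, 3, 4, 5, 6::nat}" by (auto simp: atMost_nat_numeral)
  finally show ?thesis by simp
qed

lemma interval_1_6: "{Suc 0..6} = {1, 2, 3, 4, 5, 6}"
  by auto

lemma sum_le_6: "(\<Sum>k\<le>6. g k) = g 0 + g 1 + g 2 + g 3 + g 4 + g 5 + g (6::nat)"
  by (simp add: eval_nat_numeral)

text \<open>Completing squares and splitting the quadratic form into its symmetric and antisymmetric parts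
  under the reflection of the base graph gives the rational Gram factors; both matrices have rank 6.\<close>

lemma twin_certificate: "lift_certificate 6 twin_edges twin_matrix"
  unfolding lift_certificate_def
proof (intro conjI)
  define d :: "nat \<Rightarrow> real" where "d k = [3, 3, 1/2, 9, 3/2, 3, 0] ! k / 62" for k
  define W :: "nat \<Rightarrow> nat \<Rightarrow> real" where "W k a =
    [[2, 0,  1,  1,  0, 1,  1],
     [4, 3,  1,  1,  3, 0,  0],
     [2, 0,  3,  3,  0, 0,  0],
     [0, 1, -1,  1, -1, 0,  0],
     [0, 0,  1, -1,  0, 0,  0],
     [0, 0,  0,  0,  0, 1, -1],
     [0, 0,  0,  0,  0, 0,  0]] ! k ! a" for k a
  show "\<exists>d W. \<forall>a\<le>6. \<forall>b\<le>6. twin_matrix a b = (\<Sum>k\<le>6. d k * W k a * W k b) \<and> 0 \<le> d a"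
    by (rule exI[of _ d], rule exI[of _ W])
      (simp add: all_le_6 sum_le_6 d_def W_def twin_matrix_def)
qed (simp_all add: interval_1_6 edge_cone_def twin_edges_def twin_matrix_def)

lemma chord_certificate: "lift_certificate 6 chord_edges chord_matrix"
  unfolding lift_certificate_def
proof (intro conjI)
  define d :: "nat \<Rightarrow> real" where "d k = [3, 1/3, 5/2, 1/6, 15/2, 15/2, 0] ! k / 76" for k
  define W :: "nat \<Rightarrow> nat \<Rightarrow> real" where "W k a =
    [[1, 0,  0, 0, 1,  0, 1],
     [9, 5,  5, 0, 9,  0, 0],
     [4, 1,  1, 3, 0,  3, 0],
     [6, 5,  5, 0, 0,  0, 0],
     [0, 1, -1, 1, 0, -1, 0],
     [0, 1, -1, 0, 0,  0, 0],
     [0, 0,  0, 0, 0,  0, 0]] ! k ! a" for k a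
  show "\<exists>d W. \<forall>a\<le>6. \<forall>b\<le>6. chord_matrix a b = (\<Sum>k\<le>6. d k * W k a * W k b) \<and> 0 \<le> d a"
    by (rule exI[of _ d], rule exI[of _ W])
      (simp add: all_le_6 sum_le_6 d_def W_def chord_matrix_def)
qed (simp_all add: interval_1_6 edge_cone_def chord_edges_def chord_matrix_def)

section \<open>Even subdivisions of the base graphs\<close>

lemma sum_even_pairs: "(\<Sum>i<2 * n. g i) = (\<Sum>s<n. g (2 * s) + g (2 * s + 1 :: nat))"
  for g :: "nat \<Rightarrow> real"
  by (induction n) (simp_all add: numeral_2_eq_2)

text \<open>In the form assignments below, consecutive positions \<open>2 * s\<close>, \<open>2 * s + 1\<close> carry \<open>y\<^sub>a\<close>, \<open>1 - y\<^sub>a\<close>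
  except for three pairs, which together carry the six coordinates.\<close>

lemma sum_pairs_three_exceptions:
  fixes g :: "nat \<Rightarrow> real"
  assumes "a < n" "b < n" "c < n" "a \<noteq> b" "a \<noteq> c" "b \<noteq> c"
    and "\<And>s. s < n \<Longrightarrow> s \<noteq> a \<Longrightarrow> s \<noteq> b \<Longrightarrow> s \<noteq> c \<Longrightarrow> g (2 * s) + g (2 * s + 1) = 1"
  shows "(\<Sum>i<2 * n. g i) = real n - 3 + (g (2 * a) + g (2 * a + 1)) + (g (2 * b) + g (2 * b + 1))
    + (g (2 * c) + g (2 * c + 1))"
proof -
  let ?h = "\<lambda>s. g (2 * s) + g (2 * s + 1)"
  have "(\<Sum>i<2 * n. g i) = sum ?h ({..<n} - {a, b, c}) + sum ?h {a, b, c}"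
    unfolding sum_even_pairs using assms by (intro sum.subset_diff) auto
  also have "sum ?h ({..<n} - {a, b, c}) = (\<Sum>s\<in>{..<n} - {a, b, c}. 1)"
    using assms by (intro sum.cong) auto
  also have "\<dots> = real (card {..<n} - card {a, b, c})"
    using assms by (subst card_Diff_subset[symmetric]) auto
  also have "card {a, b, c} = 3" using assms by simp
  finally show ?thesis using assms by (simp add: of_nat_diff)
qed

text \<open>The three paths have lengths \<open>c\<close>, \<open>D - c\<close> and
  \<open>N - D\<close>. If the even one has length at least 4, the theta is an even subdivision of a
  5-cycle with a doubled edge. Otherwise \<open>6 \<le> N\<close> makes one of the odd paths have
  length at least 3, and the theta subdivides a 5-cycle with a chord.\<close>

lemma theta_imperfect:
  fixes H :: "('v, 'e::finite) multigraph"
  assumes wf: "wf_multigraph H" and th: "theta_walk H w t c D N" and N: "6 \<le> N"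
  shows "N_plus_imperfect (line_graph H)"
proof -
  have par: "even c" "2 \<le> c" "c < D" "odd D" "D < N" "even N"
    using th by (auto simp: theta_walk_def)
  obtain n where n: "N = 2 * n" using par by blast
  obtain k where k: "D = 2 * k + 1" using par by (auto elim: oddE)
  obtain l where l: "c = 2 * l" using par by blast
  have "4 \<le> c \<or> c = 2" "5 \<le> D \<or> D = 3" using par(2,3) k l by auto
  then consider (twin) "4 \<le> c" | (chord1) "c = 2" "5 \<le> D" | (chord2) "c = 2" "D = 3"
    by blast
  then show ?thesis
  proof cases
    case twin
    \<comment> \<open>The even path carries 1, 2, 3, 4 and the odd paths carry the twins 5 and 6.
      Stretches carrying 4, 5 or 6 alternate \<open>Pos\<close> and \<open>Neg\<close> and have odd
      length, so each begins and ends with \<open>Pos\<close>.\<close>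
    define f where "f i = (if i = 0 then Pos 1 else if i = 1 then Pos 2 else if i = 2 then Pos 3
      else if i < c then (if odd i then Pos 4 else Neg 4)
      else if i < D then (if even i then Pos 5 else Neg 5)
      else (if odd i then Pos 6 else Neg 6))" for i
    show ?thesis
    proof (rule theta_walk_imperfect[OF wf th twin_certificate])
      show "form_within 6 (f i)" for i by (simp add: f_def)
      show "compatible twin_edges (f i) (f (Suc i))" for i
      proof -
        consider "i = 0" | "i = 1" | "i = 2" | "2 < i" "Suc i < c" | "Suc i = c"
          | "c \<le> i" "Suc i < D" | "Suc i = D" | "D \<le> i" by linarith
        then show ?thesis
          using par twin by cases (auto simp: f_def twin_edges_def)
      qed
      show "compatible twin_edges (f 0) (f (D - 1))" "compatible twin_edges (f 0) (f D)"
        "compatible twin_edges (f c) (f (N - 1))"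
        using par twin by (auto simp: f_def twin_edges_def)
      show "compatible twin_edges (f (c - 1)) (f (N - 1))"
        using par twin by (auto simp: f_def twin_edges_def)
      \<comment> \<open>The exceptional pairs carry 1 and 2, then 3 and 4, then 5 and 6; the last
        one consists of positions \<open>D - 1\<close> and \<open>D\<close>, on either side of the
        branch node.\<close>
      have "(\<Sum>i<2 * n. form_value (f i) (twin_matrix 0)) = real n - 3
        + (form_value (f (2 * 0)) (twin_matrix 0) + form_value (f (2 * 0 + 1)) (twin_matrix 0))
        + (form_value (f (2 * 1)) (twin_matrix 0) + form_value (f (2 * 1 + 1)) (twin_matrix 0))
        + (form_value (f (2 * k)) (twin_matrix 0) + form_value (f (2 * k + 1)) (twin_matrix 0))"
      proof (rule sum_pairs_three_exceptions)
        show "form_value (f (2 * s)) (twin_matrix 0) + form_value (f (2 * s + 1)) (twin_matrix 0) = 1"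
          if s: "s < n" "s \<noteq> 0" "s \<noteq> 1" "s \<noteq> k" for s
        proof -
          consider "s < l" | "l \<le> s" "s < k" | "k < s" using s by linarith
          then show ?thesis
            using s par k l by cases (auto simp: f_def twin_matrix_def)
        qed
      qed (use n k par twin in auto)
      moreover have "f (2 * k) = Pos 5" "f (2 * k + 1) = Pos 6" "f 3 = Pos 4"
        using par k twin by (auto simp: f_def)
      ultimately show "2 * (\<Sum>i<N. form_value (f i) (twin_matrix 0)) > real N - 2"
        by (simp add: f_def[of 0] f_def[of "Suc 0"] f_def[of 2] n twin_matrix_def)
    qed
  next
    case chord1
    \<comment> \<open>The even path carries 1, 2, the first odd path 3, 4, 5 with 5 subdivided, and
      the second odd path the chord 6.\<close>
    define f where "f i = (if i = 0 then Pos 1 else if i = 1 then Pos 2 else if i = 2 then Pos 3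
      else if i = 3 then Pos 4
      else if i < D then (if even i then Pos 5 else Neg 5)
      else (if odd i then Pos 6 else Neg 6))" for i
    show ?thesis
    proof (rule theta_walk_imperfect[OF wf th chord_certificate])
      show "form_within 6 (f i)" for i by (simp add: f_def)
      show "compatible chord_edges (f i) (f (Suc i))" for i
      proof -
        consider "i = 0" | "i = 1" | "i = 2" | "i = 3" | "3 < i" "Suc i < D" | "Suc i = D" | "D \<le> i"
          by linarith
        then show ?thesis
          using par chord1 by cases (auto simp: f_def chord_edges_def)
      qed
      show "compatible chord_edges (f 0) (f (D - 1))" "compatible chord_edges (f 0) (f D)"
        "compatible chord_edges (f c) (f (N - 1))" "compatible chord_edges (f (c - 1)) (f (N - 1))"
        using par chord1 by (auto simp: f_def chord_edges_def)
      have "(\<Sum>i<2 * n. form_value (f i) (chord_matrix 0)) = real n - 3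
        + (form_value (f (2 * 0)) (chord_matrix 0) + form_value (f (2 * 0 + 1)) (chord_matrix 0))
        + (form_value (f (2 * 1)) (chord_matrix 0) + form_value (f (2 * 1 + 1)) (chord_matrix 0))
        + (form_value (f (2 * k)) (chord_matrix 0) + form_value (f (2 * k + 1)) (chord_matrix 0))"
      proof (rule sum_pairs_three_exceptions)
        show "form_value (f (2 * s)) (chord_matrix 0) + form_value (f (2 * s + 1)) (chord_matrix 0) = 1"
          if s: "s < n" "s \<noteq> 0" "s \<noteq> 1" "s \<noteq> k" for s
        proof -
          consider "s < k" | "k < s" using s by linarith
          then show ?thesis
            using s par k by cases (auto simp: f_def chord_matrix_def)
        qed
      qed (use n k par chord1 in auto)
      moreover have "f (2 * k) = Pos 5" "f (2 * k + 1) = Pos 6" "f 3 = Pos 4"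
        using par k chord1 by (auto simp: f_def)
      ultimately show "2 * (\<Sum>i<N. form_value (f i) (chord_matrix 0)) > real N - 2"
        by (simp add: f_def[of 0] f_def[of "Suc 0"] f_def[of 2] n chord_matrix_def)
    qed
  next
    case chord2
    \<comment> \<open>Here the first odd path is the single edge 6. The second is traversed in the
      opposite direction, so it carries 5, 4, 3 with 3 subdivided.\<close>
    define f where "f i = (if i = 0 then Pos 1 else if i = 1 then Pos 2 else if i = 2 then Pos 6
      else if i = 3 then Pos 5 else if i = 4 then Pos 4
      else if odd i then Pos 3 else Neg 3)" for i :: nat
    show ?thesis
    proof (rule theta_walk_imperfect[OF wf th chord_certificate])
      show "form_within 6 (f i)" for i by (simp add: f_def)
      show "compatible chord_edges (f i) (f (Suc i))" for i
      proof -
        consider "i = 0" | "i = 1" | "i = 2" | "i = 3" | "i = 4" | "4 < i" by linarith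
        then show ?thesis by cases (auto simp: f_def chord_edges_def)
      qed
      show "compatible chord_edges (f 0) (f (D - 1))" "compatible chord_edges (f 0) (f D)"
        "compatible chord_edges (f c) (f (N - 1))" "compatible chord_edges (f (c - 1)) (f (N - 1))"
        using par chord2 N by (auto simp: f_def chord_edges_def)
      have "(\<Sum>i<2 * n. form_value (f i) (chord_matrix 0)) = real n - 3
        + (form_value (f (2 * 0)) (chord_matrix 0) + form_value (f (2 * 0 + 1)) (chord_matrix 0))
        + (form_value (f (2 * 1)) (chord_matrix 0) + form_value (f (2 * 1 + 1)) (chord_matrix 0))
        + (form_value (f (2 * 2)) (chord_matrix 0) + form_value (f (2 * 2 + 1)) (chord_matrix 0))"
      proof (rule sum_pairs_three_exceptions)
        show "form_value (f (2 * s)) (chord_matrix 0) + form_value (f (2 * s + 1)) (chord_matrix 0) = 1"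
          if "s < n" "s \<noteq> 0" "s \<noteq> 1" "s \<noteq> 2" for s
          using that by (auto simp: f_def chord_matrix_def)
      qed (use n N in auto)
      then show "2 * (\<Sum>i<N. form_value (f i) (chord_matrix 0)) > real N - 2"
        by (simp add: f_def n chord_matrix_def)
    qed
  qed
qed

section \<open>Odd cycles with an odd ear\<close>

definition odd_cycle :: "('v, 'e) multigraph \<Rightarrow> nat \<Rightarrow> (nat \<Rightarrow> 'v) \<Rightarrow> (nat \<Rightarrow> 'e) \<Rightarrow> bool" where
  "odd_cycle H D p q \<longleftrightarrow> odd D \<and> 3 \<le> D \<and> inj_on p {..<D} \<and>
     (\<forall>i<D. q i \<in> edges H \<and> ends H (q i) = {p i, p (Suc i mod D)})"

lemma odd_cycle_same_node:
  assumes "odd_cycle H D p q" "i < D" "j < D"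
  shows "p i = p j \<longleftrightarrow> i = j" "p (Suc i mod D) = p j \<longleftrightarrow> Suc i mod D = j"
    "p i = p (Suc j mod D) \<longleftrightarrow> i = Suc j mod D" "p (Suc i mod D) = p (Suc j mod D) \<longleftrightarrow> i = j"
proof -
  have D: "3 \<le> D" and inj: "inj_on p {..<D}" using assms by (auto simp: odd_cycle_def)
  have *: "Suc i mod D < D" "Suc j mod D < D" using D by simp_all
  show "p i = p j \<longleftrightarrow> i = j" "p (Suc i mod D) = p j \<longleftrightarrow> Suc i mod D = j"
    "p i = p (Suc j mod D) \<longleftrightarrow> i = Suc j mod D"
    using inj_on_eq_iff[OF inj] assms * by simp_all
  have "Suc i mod D = Suc j mod D \<longleftrightarrow> i = j" using assms by (auto simp: mod_Suc)
  then show "p (Suc i mod D) = p (Suc j mod D) \<longleftrightarrow> i = j"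
    using inj_on_eq_iff[OF inj] * by simp
qed

lemma odd_cycle_inj_edges:
  assumes cyc: "odd_cycle H D p q"
  shows "inj_on q {..<D}"
proof (rule inj_onI)
  fix i j assume ij: "i \<in> {..<D}" "j \<in> {..<D}" "q i = q j"
  then have "{p i, p (Suc i mod D)} = {p j, p (Suc j mod D)}"
    using cyc unfolding odd_cycle_def by (metis lessThan_iff)
  then have "i = j \<or> i = Suc j mod D \<and> Suc i mod D = j"
    using odd_cycle_same_node[OF cyc, of i j] ij by (auto simp: doubleton_eq_iff)
  then show "i = j"
    using ij cyc by (auto simp: mod_Suc odd_cycle_def split: if_splits)
qed

text \<open>The trail runs once around the cycle from \<open>p a\<close>, passing \<open>p b\<close>
  after an even arc and returning along the odd one, and then follows the ear to
  \<open>p b\<close>.\<close>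

lemma even_arc_imperfect:
  fixes H :: "('v, 'e::finite) multigraph"
  assumes wf: "wf_multigraph H" and cyc: "odd_cycle H D p q"
    and ab: "a < D" "b < D" "a \<noteq> b" and even: "even (if a < b then b - a else b + D - a)"
    and J: "distinct J" "set J \<inter> p ` {..<D} = {}" "even (length J)" "5 \<le> D + length J"
    and g: "\<And>i. i \<le> length J \<Longrightarrow> g i \<in> edges H \<and>
      ends H (g i) = {(p a # J @ [p b]) ! i, (p a # J @ [p b]) ! Suc i}"
    and disj: "g ` {..length J} \<inter> q ` {..<D} = {}"
  shows "N_plus_imperfect (line_graph H)"
proof -
  have D: "odd D" "3 \<le> D" and inj: "inj_on p {..<D}"
    and q: "\<And>i. i < D \<Longrightarrow> q i \<in> edges H \<and> ends H (q i) = {p i, p (Suc i mod D)}"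
    using cyc by (auto simp: odd_cycle_def)
  define xs where "xs = p a # J @ [p b]"
  define c where "c = (if a < b then b - a else b + D - a)"
  define N where "N = D + length J + 1"
  \<comment> \<open>Addition of \<open>a\<close> modulo \<open>D\<close>, rotating the cycle to
    start at \<open>p a\<close>.\<close>
  define r where "r i = (if a + i < D then a + i else a + i - D)" for i
  \<comment> \<open>Position \<open>D\<close> is read from the ear, so
    \<open>w D = p a = w 0\<close>, and position \<open>N\<close> gives
    \<open>p b = w c\<close>.\<close>
  define w where "w i = (if i < D then p (r i) else xs ! (i - D))" for i
  define t where "t i = (if i < D then q (r i) else g (i - D))" for i
  have rD: "r i < D" if "i < D" for i using that ab by (auto simp: r_def)
  have r_inj: "r i = r j \<longleftrightarrow> i = j" if "i < D" "j < D" for i j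
    using that ab by (auto simp: r_def)
  have ra: "r i = a \<longleftrightarrow> i = 0" if "i < D" for i using that ab by (auto simp: r_def)
  have rb: "r i = b \<longleftrightarrow> i = c" if "i < D" for i using that ab by (auto simp: r_def c_def)
  have pr: "p (r i) = p j \<longleftrightarrow> r i = j" if "i < D" "j < D" for i j
    using inj_on_eq_iff[OF inj] that rD by simp
  have c: "0 < c" "c < D" using ab by (auto simp: c_def)
  have xs_nth: "xs ! 0 = p a" "xs ! Suc (length J) = p b"
    "\<And>i. i < length J \<Longrightarrow> xs ! Suc i = J ! i"
    by (auto simp: xs_def nth_append)
  have xs_in: "xs ! i \<in> p ` {..<D} \<longleftrightarrow> i = 0 \<or> i = Suc (length J)" if i: "i \<le> Suc (length J)" for i
  proof -
    consider "i = 0" | "i = Suc (length J)" | i' where "i = Suc i'" "i' < length J"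
      using i by (cases i) (auto simp: le_less)
    then show ?thesis
    proof cases
      case 3
      then have "xs ! i \<in> set J" by (simp add: xs_nth)
      then show ?thesis using J(2) 3 by auto
    qed (use ab xs_nth in auto)
  qed
  have "distinct xs"
    using J(1,2) ab inj_on_eq_iff[OF inj, of a b] by (auto simp: xs_def)
  then have xs_inj: "xs ! i = xs ! j \<longleftrightarrow> i = j" if "i \<le> Suc (length J)" "j \<le> Suc (length J)" for i j
    using that by (intro nth_eq_iff_index_eq) (auto simp: xs_def)
  have w_eq: "w i = w j \<longleftrightarrow> i = 0 \<and> j = D \<or> i = c \<and> j = N" if ij: "i < j" "j \<le> N" for i j
  proof -
    consider "j < D" | "i < D" "D \<le> j" | "D \<le> i" using ij by linarith
    then show ?thesis
    proof cases
      case 1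
      then show ?thesis using ij pr[of i "r j"] rD[of j] r_inj[of i j] c by (auto simp: w_def N_def)
    next
      case 2
      have iN: "j - D \<le> Suc (length J)" using ij by (auto simp: N_def)
      show ?thesis
      proof (cases "j = D \<or> j = N")
        case True
        then show ?thesis
          using 2 ab pr[of i a] pr[of i b] ra[of i] rb[of i] xs_nth(1,2) c
          by (auto simp: w_def N_def)
      next
        case False
        then have "xs ! (j - D) \<notin> p ` {..<D}" using xs_in[OF iN] 2 by (auto simp: N_def)
        then have "p (r i) \<noteq> xs ! (j - D)" using rD[OF 2(1)] by (metis imageI lessThan_iff)
        then show ?thesis using False 2 by (auto simp: w_def)
      qed
    next
      case 3
      then show ?thesis using ij xs_inj[of "i - D" "j - D"] c by (auto simp: w_def N_def)
    qed
  qed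
  have edges: "t i \<in> edges H \<and> ends H (t i) = {w i, w (Suc i)}" if i: "i < N" for i
  proof (cases "i < D")
    case True
    have "p (Suc (r i) mod D) = w (Suc i)"
    proof (cases "Suc i < D")
      case True
      then have "Suc (r i) mod D = r (Suc i)" using ab by (auto simp: r_def mod_Suc)
      then show ?thesis using True by (simp add: w_def)
    next
      case False
      then have "Suc i = D" using \<open>i < D\<close> by simp
      moreover have "Suc (r i) mod D = a" using ab \<open>Suc i = D\<close> by (auto simp: r_def mod_Suc)
      ultimately show ?thesis by (simp add: w_def xs_nth)
    qed
    then show ?thesis using True q[OF rD[OF True]] by (simp add: t_def w_def)
  next
    case False
    then have "Suc i - D = Suc (i - D)" "i - D \<le> length J" using i by (auto simp: N_def)
    then show ?thesis using False g[of "i - D"] by (simp add: t_def w_def xs_def)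
  qed
  have g_inj: "g i \<noteq> g j" if "i < j" "j \<le> length J" for i j
  proof
    assume "g i = g j"
    then have "{xs ! i, xs ! Suc i} = {xs ! j, xs ! Suc j}"
      using g[of i] g[of j] that by (simp add: xs_def)
    then show False
      using xs_inj[of i j] xs_inj[of i "Suc j"] that by (auto simp: doubleton_eq_iff)
  qed
  have t_ne: "t i \<noteq> t j" if "i < j" "j < N" for i j
  proof -
    consider "j < D" | "i < D" "D \<le> j" | "D \<le> i" using that by linarith
    then show ?thesis
    proof cases
      case 1
      then show ?thesis
        using that inj_on_eq_iff[OF odd_cycle_inj_edges[OF cyc], of "r i" "r j"] r_inj[of i j] rD
        by (simp add: t_def)
    next
      case 2
      then have "q (r i) \<in> q ` {..<D}" "g (j - D) \<in> g ` {..length J}"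
        using rD[of i] that by (auto simp: N_def)
      then show ?thesis using 2 disj by (auto simp: t_def)
    next
      case 3
      then show ?thesis using that g_inj[of "i - D" "j - D"] by (simp add: t_def N_def)
    qed
  qed
  have "inj_on t {..<N}"
    by (rule linorder_inj_onI') (use t_ne in auto)
  moreover have ceven: "even c" using even by (simp only: c_def)
  moreover have "2 \<le> c" using c ceven by (cases "c = 1") auto
  ultimately have "theta_walk H w t c D N"
    unfolding theta_walk_def using c D J(3) edges w_eq by (intro conjI allI impI) (simp_all add: N_def)
  then show ?thesis
    by (rule theta_imperfect[OF wf]) (use J(4) in \<open>simp add: N_def\<close>)
qed

text \<open>Since \<open>D\<close> is odd, exactly one of the two arcs between the ends of the ear
  is even. If it leads from \<open>y\<close> to \<open>x\<close>, the ear is reversed.\<close>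

lemma odd_ear_imperfect:
  fixes H :: "('v, 'e::finite) multigraph"
  assumes wf: "wf_multigraph H" and cyc: "odd_cycle H D p q"
    and xy: "x \<in> p ` {..<D}" "y \<in> p ` {..<D}" "x \<noteq> y"
    and J: "distinct J" "set J \<inter> p ` {..<D} = {}" "even (length J)" "5 \<le> D + length J"
    and g: "\<And>i. i \<le> length J \<Longrightarrow> g i \<in> edges H \<and>
      ends H (g i) = {(x # J @ [y]) ! i, (x # J @ [y]) ! Suc i}"
    and disj: "g ` {..length J} \<inter> q ` {..<D} = {}"
  shows "N_plus_imperfect (line_graph H)"
proof -
  obtain a b where ab: "a < D" "b < D" "x = p a" "y = p b" "a \<noteq> b" using xy by auto
  show ?thesis
  proof (cases "even (if a < b then b - a else b + D - a)")
    case True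
    show ?thesis
      by (rule even_arc_imperfect[OF wf cyc ab(1,2,5) True J g[unfolded ab(3,4)] disj])
  next
    case False
    have even: "even (if b < a then a - b else a + D - b)"
      using False ab cyc by (auto simp: odd_cycle_def split: if_splits)
    define g' where "g' i = g (length J - i)" for i
    have "g' ` {..length J} = g ` {..length J}"
    proof -
      have "(\<lambda>i. length J - i) ` {..length J} = {..length J}"
      proof
        show "{..length J} \<subseteq> (\<lambda>i. length J - i) ` {..length J}"
        proof
          fix i assume "i \<in> {..length J}"
          then show "i \<in> (\<lambda>i. length J - i) ` {..length J}"
            by (intro image_eqI[of _ _ "length J - i"]) auto
        qed
      qed auto
      then show ?thesis unfolding g'_def by (metis image_image)
    qed
    then have disj': "g' ` {..length J} \<inter> q ` {..<D} = {}" using disj by simp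
    have rev: "(y # rev J @ [x]) ! i = (x # J @ [y]) ! (Suc (length J) - i)"
      if "i \<le> Suc (length J)" for i
      using rev_nth[of i "x # J @ [y]"] that by simp
    have g': "g' i \<in> edges H \<and>
      ends H (g' i) = {(y # rev J @ [x]) ! i, (y # rev J @ [x]) ! Suc i}" if "i \<le> length J" for i
      using g[of "length J - i"] rev[of i] rev[of "Suc i"] that
      by (simp add: g'_def Suc_diff_le insert_commute)
    show ?thesis
    proof (rule even_arc_imperfect[OF wf cyc ab(2,1) ab(5)[symmetric] even, of "rev J" g'])
      show "g' i \<in> edges H \<and>
        ends H (g' i) = {(p b # rev J @ [p a]) ! i, (p b # rev J @ [p a]) ! Suc i}"
        if "i \<le> length (rev J)" for i
        using g'[of i] that by (simp only: ab(3,4) length_rev)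
    qed (use J disj' in simp_all)
  qed
qed

lemma odd_cycle_line_graph:
  assumes cyc: "odd_cycle H D p q" and E: "edges H = q ` {..<D}" and D: "5 \<le> D"
  shows "is_odd_hole (line_graph H)"
proof -
  obtain k where k: "D = 2 * k + 1" using cyc by (auto simp: odd_cycle_def elim: oddE)
  have bij: "bij_betw q {..<D} (edges H)"
    using odd_cycle_inj_edges[OF cyc] E by (simp add: bij_betw_def)
  have "{q i, q j} \<in> snd (line_graph H) \<longleftrightarrow> j = Suc i mod D \<or> i = Suc j mod D"
    if ij: "i < D" "j < D" for i j
  proof -
    have e: "q i \<in> edges H" "q j \<in> edges H" "ends H (q i) = {p i, p (Suc i mod D)}"
      "ends H (q j) = {p j, p (Suc j mod D)}" using cyc ij by (auto simp: odd_cycle_def)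
    have "{q i, q j} \<in> snd (line_graph H) \<longleftrightarrow> q i \<noteq> q j \<and> ends H (q i) \<inter> ends H (q j) \<noteq> {}"
      using e(1,2) by (auto simp: line_graph_def doubleton_eq_iff)
    also have "q i \<noteq> q j \<longleftrightarrow> i \<noteq> j"
      using inj_on_eq_iff[OF odd_cycle_inj_edges[OF cyc]] ij by simp
    also have "ends H (q i) \<inter> ends H (q j) \<noteq> {} \<longleftrightarrow> i = j \<or> i = Suc j mod D \<or> Suc i mod D = j"
      using odd_cycle_same_node[OF cyc ij] unfolding e by auto
    finally show ?thesis using ij D by (auto simp: mod_Suc split: if_splits)
  qed
  then show ?thesis
    unfolding is_odd_hole_def
    by (intro exI[of _ k] exI[of _ q]) (use bij D in \<open>simp add: k line_graph_def\<close>)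
qed

text \<open>Two disjoint edges would need four nodes.\<close>

lemma three_nodes_clique:
  assumes wf: "wf_multigraph H" and "card (nodes H) \<le> 3"
  shows "is_clique (line_graph H)"
proof -
  have "ends H e \<inter> ends H f \<noteq> {}" if ef: "e \<in> edges H" "f \<in> edges H" for e f
  proof
    assume "ends H e \<inter> ends H f = {}"
    moreover have "card (ends H e) = 2" "card (ends H f) = 2" "ends H e \<union> ends H f \<subseteq> nodes H"
      "finite (nodes H)"
      using wf ef by (auto simp: wf_multigraph_def)
    moreover from this have "finite (ends H e)" "finite (ends H f)"
      by (auto intro: finite_subset)
    ultimately show False
      using card_Un_disjoint[of "ends H e" "ends H f"] card_mono[of "nodes H" "ends H e \<union> ends H f"]
        assms(2) by simp
  qed
  then have "{e, f} \<in> snd (line_graph H)" if "e \<in> edges H" "f \<in> edges H" "e \<noteq> f" for e f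
    using that unfolding line_graph_def snd_conv by (intro CollectI exI[of _ e] exI[of _ f] conjI refl)
  then show ?thesis by (simp add: is_clique_def line_graph_def)
qed

section \<open>Spanning and non-spanning odd cycles\<close>

theorem theorem4:
  fixes H :: "('v, 'e::finite) multigraph"
  assumes "wf_multigraph H"
    and "two_connected H"
    and "hypomatchable H"
  shows "is_clique (line_graph H) \<or> is_odd_hole (line_graph H) \<or>
    N_plus_imperfect (line_graph H)"
proof (cases "edges H = {}")
  case True
  \<comment> \<open>Without edges the line graph is empty, hence a clique.\<close>
  then show ?thesis by (simp add: is_clique_def line_graph_def)
next
  case False
  note wf = assms(1)
  let ?R = "adjacent H" and ?V = "nodes H"
  have fin: "finite ?V" using wf by (simp add: wf_multigraph_def)
  have irrefl: "\<not> ?R u u" for u using adjacentD[OF wf] by blast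
  have symR: "?R v u" if "?R u v" for u v using adjacent_sym that .
  have RV: "u \<in> ?V \<and> v \<in> ?V" if "?R u v" for u v using adjacentD[OF wf that] by blast
  have conn: "(u, w) \<in> {(a, b). ?R a b}\<^sup>*" if "u \<in> ?V" "w \<in> ?V" for u w
    using assms(2) that by (simp add: two_connected_def connected_graph_def adjacent_def)
  have conn2: "(u, w) \<in> {(a, b). ?R a b \<and> a \<noteq> x \<and> b \<noteq> x}\<^sup>*"
    if "x \<in> ?V" "u \<in> ?V - {x}" "w \<in> ?V - {x}" for x u w
  proof -
    have "connected_graph (delete_node H x)" using assms(2) that by (simp add: two_connected_def)
    then have "(u, w) \<in> {(a, b). \<exists>e\<in>edges (delete_node H x). ends (delete_node H x) e = {a, b}}\<^sup>*"
      using that unfolding connected_graph_def by (simp add: delete_node_def)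
    also have "{(a, b). \<exists>e\<in>edges (delete_node H x). ends (delete_node H x) e = {a, b}} =
        {(a, b). ?R a b \<and> a \<noteq> x \<and> b \<noteq> x}"
      by (auto simp: delete_node_def adjacent_def)
    finally show ?thesis .
  qed
  have hypo: "\<exists>m. matching_map ?R ?V v m" if "v \<in> ?V" for v
    using hypomatchable_matching_map[OF wf assms(3) that] .
  obtain e where e: "e \<in> edges H" using False by blast
  then have "card (ends H e) = 2" using wf by (simp add: wf_multigraph_def)
  then obtain r s where "ends H e = {s, r}" by (meson card_2_iff)
  then have sr: "?R s r" using e by (auto simp: adjacent_def)
  then have rs: "r \<in> ?V" "s \<in> ?V" using RV by blast+
  obtain m m' where m: "matching_map ?R ?V r m" "matching_map ?R ?V s m'"
    using hypo rs by blast
  have "\<exists>p k. 1 \<le> k \<and> inj_on p {..2 * k} \<and> p ` {..2 * k} \<subseteq> ?V \<and>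
      (\<forall>i<2 * k. ?R (p i) (p (Suc i))) \<and> ?R (p (2 * k)) (p 0) \<and>
      (\<forall>u\<in>?V - p ` {..2 * k}. m u \<in> ?V - p ` {..2 * k} \<and> m (m u) = u \<and> ?R u (m u))"
    by (rule nice_odd_cycle[of ?V ?R r s m m']) (fact fin irrefl symR rs sr m)+
  then obtain p k where k: "1 \<le> k" and inj: "inj_on p {..2 * k}" and pV: "p ` {..2 * k} \<subseteq> ?V"
    and adj: "\<And>i. i < 2 * k \<Longrightarrow> ?R (p i) (p (Suc i))" "?R (p (2 * k)) (p 0)"
    and mC: "\<And>u. u \<in> ?V - p ` {..2 * k} \<Longrightarrow> m u \<in> ?V - p ` {..2 * k} \<and> m (m u) = u \<and> ?R u (m u)"
    by blast
  define D where "D = 2 * k + 1"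
  have D: "{..2 * k} = {..<D}" "odd D" "3 \<le> D" using k by (auto simp: D_def)
  have "\<exists>e\<in>edges H. ends H e = {p i, p (Suc i mod D)}" if "i < D" for i
    using adj that by (cases "i = 2 * k") (auto simp: adjacent_def D_def)
  then obtain q where "\<And>i. i < D \<Longrightarrow> q i \<in> edges H \<and> ends H (q i) = {p i, p (Suc i mod D)}"
    by metis
  then have cyc: "odd_cycle H D p q" using D inj by (simp add: odd_cycle_def)
  let ?C = "p ` {..<D}"
  show ?thesis
  proof (cases "?C = ?V")
    case True
    have card: "card ?V = D" using inj card_image[of p "{..<D}"] D True by simp
    show ?thesis
    proof (cases "edges H = q ` {..<D}")
      case cycle: True
      show ?thesis
      proof (cases "5 \<le> D")
        case True
        then show ?thesis using odd_cycle_line_graph[OF cyc cycle] by blast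
      next
        case False
        then have "card ?V \<le> 3" using card by (simp add: D_def)
        then show ?thesis using three_nodes_clique[OF wf] by blast
      qed
    next
      case False
      then obtain e where e: "e \<in> edges H" "e \<notin> q ` {..<D}" using cyc by (auto simp: odd_cycle_def)
      then have "card (ends H e) = 2" "ends H e \<subseteq> ?C"
        using wf True by (simp_all add: wf_multigraph_def)
      then obtain x y where xy: "ends H e = {x, y}" "x \<noteq> y" "x \<in> ?C" "y \<in> ?C"
        by (metis card_2_iff insert_subset)
      show ?thesis
      proof (cases "5 \<le> D")
        case True
        \<comment> \<open>The extra edge, a chord or a parallel of a cycle edge, is an ear without
          inner nodes.\<close>
        have "N_plus_imperfect (line_graph H)"
          by (rule odd_ear_imperfect[OF wf cyc, of x y "[]" "\<lambda>_. e"])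
            (use e xy True in simp_all)
        then show ?thesis by blast
      next
        case False
        then have "card ?V \<le> 3" using card by (simp add: D_def)
        then show ?thesis using three_nodes_clique[OF wf] by blast
      qed
    qed
  next
    case False
    have sub: "?C \<subset> ?V" using False pV D by auto
    have p01: "p 0 \<in> ?C" "p 1 \<in> ?C" "p 0 \<noteq> p 1"
      using odd_cycle_same_node(1)[OF cyc, of 0 1] D by simp_all
    have mC': "m u \<in> ?V - ?C \<and> m (m u) = u \<and> ?R u (m u)" if "u \<in> ?V - ?C" for u
      using mC[of u] that unfolding D(1) by simp
    have "\<exists>x J y. odd_ear ?R ?C x J y \<and> J \<noteq> []"
      by (rule odd_ear_exists[of ?V ?R ?C "p 0" "p 1" m])
        (fact fin irrefl symR conn conn2 RV hypo sub p01 mC')+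
    then obtain x J y where ear: "odd_ear ?R ?C x J y" "J \<noteq> []" by blast
    then have J: "x \<in> ?C" "y \<in> ?C" "x \<noteq> y" "even (length J)" "distinct J" "set J \<inter> ?C = {}"
      "successively ?R (x # J @ [y])" by (auto simp: odd_ear_def)
    have "\<exists>e\<in>edges H. ends H e = {(x # J @ [y]) ! i, (x # J @ [y]) ! Suc i}" if "i \<le> length J" for i
      using J(7) that unfolding successively_conv_nth adjacent_def by auto
    then obtain g where g: "\<And>i. i \<le> length J \<Longrightarrow> g i \<in> edges H \<and>
        ends H (g i) = {(x # J @ [y]) ! i, (x # J @ [y]) ! Suc i}" by metis
    \<comment> \<open>Every ear edge has an end among the inner nodes \<open>J\<close>, so it cannot
      be one of the cycle edges.\<close>
    have "ends H (g i) \<inter> set J \<noteq> {}" if i: "i \<le> length J" for i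
    proof (cases i)
      case 0
      have "(J @ [y]) ! 0 \<in> set J" using ear(2) by (simp add: nth_append)
      then show ?thesis using g[OF i] 0 by auto
    next
      case (Suc j)
      then have "(x # J @ [y]) ! i \<in> set J" using i by (simp add: nth_append)
      then show ?thesis using g[OF i] by auto
    qed
    moreover have "ends H (q i) \<subseteq> ?C" if "i < D" for i
      using cyc that by (auto simp: odd_cycle_def)
    ultimately have "g ` {..length J} \<inter> q ` {..<D} = {}" using J(6) by fastforce
    \<comment> \<open>\<open>J\<close> is nonempty of even length, so it contributes at least two
      nodes to the three or more of the cycle.\<close>
    moreover have "5 \<le> D + length J"
    proof -
      have "length J \<noteq> 0" "length J \<noteq> 1" using J(4) ear(2) by auto
      then show ?thesis using D(3) by linarith
    qed
    ultimately have "N_plus_imperfect (line_graph H)"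
      by (intro odd_ear_imperfect[OF wf cyc J(1-3,5,6,4) _ g])
    then show ?thesis by blast
  qed
qed

end
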